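(* Let $p\in\{1,2\}$ and let $A\in\mathbb{R}^{m\times n}$ be a random matrix whose entries are i.i.d. standard Gaussians $N(0,1)$. Then there exist constants $C_p,c_{p0},c_{p1}>0$ and $s_p\in(0,1)$ such that, if $x_*\in\mathbb{R}^n$ and $b\in\mathbb{R}^m$ satisfy $\||Ax_*|^p-b\|_0\le s_p m$, then, for $m\ge c_{p0}n$, the function $$f_p(x):=\frac1m\||Ax|^p-b\|_1,\qquad x\in\mathbb{R}^n,$$ is sharp (with respect to $\operatorname{argmin} f_p$) with probability at least $1-C_p\exp(-c_{p1}m)$.
   Context: For a vector $z\in\mathbb{R}^m$, $|z|$ and $z^p$ denote the vectors of entrywise absolute values and entrywise $p$-th powers, $\|z\|_1$ is the $\ell_1$ norm, and $\|z\|_0$ is the number of nonzero entries of $z$. $\|\cdot\|$ is the Euclidean norm. The constants $C_p,c_{p0},c_{p1},s_p$ are universal (depending only on $p$). Sharpness: let $f:\mathbb{R}^n\to\mathbb{R}$ and $\mathcal{X}:=\operatorname{argmin} f$. Then $f$ is said to be sharp with respect to $\mathcal{X}$ if there is $\mu>0$ such that $f(x)\ge\min f+\mu\,\mathrm{dist}(x,\mathcal{X})$ for all $x\in\mathbb{R}^n$, where $\mathrm{dist}(x,\mathcal{X}):=\inf_{y\in\mathcal{X}}\|x-y\|$.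
   Formalization: For p = 2 the signal x_* is assumed nonzero: with p = 2, x_* = 0, b = 0 the function is ‖Ax‖²/m, which grows only quadratically away from its minimizers and is almost surely not sharp, so the claim fails there as printed. *)

theory Defs
  imports "HOL-Probability.Probability" "Jordan_Normal_Form.Matrix"
begin

unbundle no vec_syntax

definition norm2_vec :: "real vec \<Rightarrow> real" where
  "norm2_vec z = sqrt (scalar_prod z z)"

definition norm1_vec :: "real vec \<Rightarrow> real" where
  "norm1_vec z = (\<Sum>i<dim_vec z. \<bar>z $ i\<bar>)"

definition norm0_vec :: "real vec \<Rightarrow> nat" where
  "norm0_vec z = card {i. i < dim_vec z \<and> z $ i \<noteq> 0}"

definition abs_pow_vec :: "nat \<Rightarrow> real vec \<Rightarrow> real vec" where
  "abs_pow_vec p z = map_vec (\<lambda>t. \<bar>t\<bar> ^ p) z"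

definition argmin_vec :: "nat \<Rightarrow> (real vec \<Rightarrow> real) \<Rightarrow> real vec set" where
  "argmin_vec n f = {x. is_arg_min f (\<lambda>y. y \<in> carrier_vec n) x}"

definition dist_vec_set :: "real vec \<Rightarrow> real vec set \<Rightarrow> real" where
  "dist_vec_set x X = (INF y\<in>X. norm2_vec (x - y))"

(* The infimum of an unbounded or empty set of reals is a junk value in HOL.
   Nonemptiness of the argmin makes both infima genuine: the first is then the
   attained minimum of f. *)
definition sharp :: "nat \<Rightarrow> (real vec \<Rightarrow> real) \<Rightarrow> bool" where
  "sharp n f \<longleftrightarrow>
     argmin_vec n f \<noteq> {} \<and>
     (\<exists>\<mu>>0. \<forall>x\<in>carrier_vec n.
        f x \<ge> (INF y\<in>carrier_vec n. f y) + \<mu> * dist_vec_set x (argmin_vec n f))"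

definition phase_loss :: "nat \<Rightarrow> real mat \<Rightarrow> real vec \<Rightarrow> real vec \<Rightarrow> real" where
  "phase_loss p A b x = 1 / real (dim_row A) * norm1_vec (abs_pow_vec p (A *\<^sub>v x) - b)"

definition iid_gaussian_matrix :: "'w measure \<Rightarrow> nat \<Rightarrow> nat \<Rightarrow> ('w \<Rightarrow> real mat) \<Rightarrow> bool" where
  "iid_gaussian_matrix M m n A \<longleftrightarrow>
     prob_space M \<and>
     (\<forall>\<omega>\<in>space M. A \<omega> \<in> carrier_mat m n) \<and>
     prob_space.indep_vars M (\<lambda>_. borel) (\<lambda>ij \<omega>. A \<omega> $$ ij) ({..<m} \<times> {..<n}) \<and>
     (\<forall>ij\<in>{..<m} \<times> {..<n}. distributed M lborel (\<lambda>\<omega>. A \<omega> $$ ij) std_normal_density)"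

(* Inner form of "P holds with probability at least q", so that the set where P
   holds need not be measurable; for a measurable set it says that its measure is
   at least q. *)
definition with_prob_at_least :: "'w measure \<Rightarrow> real \<Rightarrow> ('w \<Rightarrow> bool) \<Rightarrow> bool" where
  "with_prob_at_least M q P \<longleftrightarrow>
     (\<exists>E\<in>sets M. measure M E \<ge> q \<and> (\<forall>\<omega>\<in>E. P \<omega>))"

end

theory Submission
  imports Defs
begin

text \<open>With high probability the rows of the matrix satisfy two conditions for all directions
  \<open>u\<close> at once: at most a quarter of the values \<open>\<bar>\<langle>a\<^sub>i, u\<rangle>\<bar>\<close> lie below \<open>\<epsilon> * \<parallel>u\<parallel>\<close>, and the sum of
  \<open>\<langle>a\<^sub>i, u\<rangle>\<^sup>2\<close> over any \<open>s * m\<close> indices is at most \<open>\<epsilon>\<^sup>2 / 16 * m * \<parallel>u\<parallel>\<^sup>2\<close>. For a fixed \<open>u\<close> this is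
  a Chernoff bound; a union bound over a net of the sphere with exponentially many points, together
  with the bound on the operator norm that the net itself provides, makes it uniform.

  On this event put \<open>u = x - x\<^sub>*\<close> and \<open>v = x + x\<^sub>*\<close>. The \<open>i\<close>-th residual changes between \<open>x\<^sub>*\<close> and
  \<open>x\<close> by \<open>min \<bar>\<langle>a\<^sub>i, u\<rangle>\<bar> \<bar>\<langle>a\<^sub>i, v\<rangle>\<bar>\<close> if \<open>p = 1\<close> and by \<open>\<bar>\<langle>a\<^sub>i, u\<rangle>\<bar> * \<bar>\<langle>a\<^sub>i, v\<rangle>\<bar>\<close> if \<open>p = 2\<close>, and the
  uncorrupted rows outweigh the corrupted ones. Hence the loss grows from \<open>x\<^sub>*\<close> at least like
  \<open>min \<parallel>u\<parallel> \<parallel>v\<parallel>\<close>, respectively \<open>\<parallel>u\<parallel> * \<parallel>v\<parallel> \<ge> \<parallel>x\<^sub>*\<parallel> * min \<parallel>u\<parallel> \<parallel>v\<parallel>\<close>, so the minimisers are \<open>\<plusminus>x\<^sub>*\<close>.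
  This is uniform in \<open>x\<^sub>*\<close> and \<open>b\<close>, which may therefore depend on the matrix.\<close>

section \<open>A net of the sphere\<close>

lemma sum_half_powers_symmetric:
  "(\<Sum>k\<in>{- int L..int L}. (1 / 2 :: real) ^ nat \<bar>k\<bar>) = 3 - 2 * (1 / 2) ^ L"
proof (induction L)
  case (Suc L)
  have "{- int (Suc L)..int (Suc L)} = insert (int (Suc L)) (insert (- int (Suc L)) {- int L..int L})"
    by auto
  then show ?case
    by (simp add: Suc nat_add_distrib)
qed simp

text \<open>Every counted point has weight at least \<open>1 / 2 ^ (R * card J)\<close>, while the
  total weight of the box is a product of coordinate sums, each at most 3. The bound is therefore
  independent of the side length \<open>L\<close>.\<close>

lemma card_lattice_ball_le:
  fixes R :: nat
  assumes "finite J"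
  shows "real (card {z \<in> J \<rightarrow>\<^sub>E {- int L..int L}. (\<Sum>j\<in>J. \<bar>z j\<bar>) \<le> int (R * card J)})
           \<le> (3 * 2 ^ R) ^ card J" (is "real (card ?Z) \<le> _")
proof -
  let ?F = "J \<rightarrow>\<^sub>E {- int L..int L}"
  have fin: "finite ?F"
    using assms by (simp add: finite_PiE)
  have weight: "1 \<le> (2::real) ^ (R * card J) * (\<Prod>j\<in>J. (1 / 2) ^ nat \<bar>z j\<bar>)" if "z \<in> ?Z" for z
  proof -
    have "int (\<Sum>j\<in>J. nat \<bar>z j\<bar>) \<le> int (R * card J)"
      using that by simp
    then have "(2::real) ^ (\<Sum>j\<in>J. nat \<bar>z j\<bar>) \<le> 2 ^ (R * card J)"
      by (intro power_increasing) (simp_all only: of_nat_le_iff one_le_numeral)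
    moreover have "(\<Prod>j\<in>J. (1 / 2 :: real) ^ nat \<bar>z j\<bar>) = 1 / 2 ^ (\<Sum>j\<in>J. nat \<bar>z j\<bar>)"
      by (metis power_one_over power_sum)
    ultimately show ?thesis
      by (simp only:) (simp add: field_simps)
  qed
  have "real (card ?Z) = (\<Sum>z\<in>?Z. 1)"
    by simp
  also have "\<dots> \<le> (\<Sum>z\<in>?Z. 2 ^ (R * card J) * (\<Prod>j\<in>J. (1 / 2) ^ nat \<bar>z j\<bar>))"
    using weight by (intro sum_mono) auto
  also have "\<dots> \<le> (\<Sum>z\<in>?F. 2 ^ (R * card J) * (\<Prod>j\<in>J. (1 / 2) ^ nat \<bar>z j\<bar>))"
    using fin by (intro sum_mono2) (auto intro!: prod_nonneg mult_nonneg_nonneg)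
  also have "\<dots> = 2 ^ (R * card J) * (\<Prod>j\<in>J. \<Sum>k\<in>{- int L..int L}. (1 / 2) ^ nat \<bar>k\<bar>)"
    using assms by (subst prod_sum_PiE) (auto simp: sum_distrib_left)
  also have "\<dots> \<le> 2 ^ (R * card J) * (\<Prod>j\<in>J. 3)"
    by (intro mult_left_mono prod_mono conjI sum_nonneg) (auto simp: sum_half_powers_symmetric)
  also have "\<dots> = (3 * 2 ^ R) ^ card J"
    by (simp add: power_mult power_mult_distrib)
  finally show ?thesis .
qed

text \<open>Rounding toward zero, rather than to the nearest integer, never lengthens a vector; this
  keeps the lattice approximation of a unit vector inside the unit ball.\<close>

lemma int_round_toward_zero: "\<exists>k::int. \<bar>x - of_int k\<bar> \<le> 1 \<and> \<bar>of_int k\<bar> \<le> \<bar>x :: real\<bar>"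
proof (cases "x \<ge> 0")
  case True
  then have "0 \<le> \<lfloor>x\<rfloor>"
    by simp
  then show ?thesis
    using True by (intro exI[of _ "\<lfloor>x\<rfloor>"] conjI) linarith+
next
  case False
  then have "\<lceil>x\<rceil> \<le> 0"
    by simp
  then show ?thesis
    using False by (intro exI[of _ "\<lceil>x\<rceil>"] conjI) linarith+
qed

lemma L2_set_cmult: "L2_set (\<lambda>j. c * f j) J = \<bar>c\<bar> * L2_set f J"
  by (simp add: L2_set_def power_mult_distrib real_sqrt_mult flip: sum_distrib_left)

lemma L2_set_power2: "(L2_set f J)\<^sup>2 = (\<Sum>j\<in>J. (f j)\<^sup>2)"
  by (simp add: L2_set_def sum_nonneg)

lemma L2_set_diff_triangle: "L2_set f J \<le> L2_set g J + L2_set (\<lambda>j. f j - g j) J"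
  using L2_set_triangle_ineq[of g "\<lambda>j. f j - g j" J] by simp

text \<open>The net consists of the normalised points of a cubic lattice; these are counted by giving
  \<open>z\<close> the weight \<open>2 powr - (\<Sum>j\<in>J. \<bar>z j\<bar>)\<close>, which factorises over the coordinates.\<close>

lemma sphere_net:
  fixes \<delta> :: real
  assumes "\<delta> > 0"
  obtains N :: real where "N > 1" and
    "\<And>J :: 'j set. finite J \<Longrightarrow> \<exists>V. finite V \<and> real (card V) \<le> N ^ card J \<and>
       (\<forall>v\<in>V. L2_set v J = 1) \<and>
       (\<forall>u. L2_set u J = 1 \<longrightarrow> (\<exists>v\<in>V. L2_set (\<lambda>j. u j - v j) J \<le> \<delta>))"
proof -
  \<comment> \<open>One half of \<open>\<delta>\<close> is spent on rounding and one half on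
    normalising; \<open>d < 1\<close> keeps the rounded vector away from zero.\<close>
  define d where "d = min (\<delta> / 2) (1 / 2)"
  have d: "0 < d" "d < 1" "2 * d \<le> \<delta>"
    using assms by (auto simp: d_def)
  \<comment> \<open>The lattice points used below have squared norm at most
    \<open>card J / d\<^sup>2\<close>, hence at most \<open>R * card J\<close>.\<close>
  define R where "R = nat \<lceil>1 / d\<^sup>2\<rceil>"
  have R: "1 / d\<^sup>2 \<le> real R"
    by (simp add: R_def of_nat_ceiling)
  have ex: "\<exists>V. finite V \<and> real (card V) \<le> (3 * 2 ^ R) ^ card J \<and>
       (\<forall>v\<in>V. L2_set v J = 1) \<and>
       (\<forall>u. L2_set u J = 1 \<longrightarrow> (\<exists>v\<in>V. L2_set (\<lambda>j. u j - v j) J \<le> \<delta>))"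
    if J: "finite J" for J :: "'j set"
  proof -
    let ?nrm = "\<lambda>z. L2_set (\<lambda>j. real_of_int (z j)) J"
    let ?Z = "{z \<in> J \<rightarrow>\<^sub>E {- int (R * card J)..int (R * card J)}. (\<Sum>j\<in>J. \<bar>z j\<bar>) \<le> int (R * card J)}"
    define V where "V = (\<lambda>z j. 1 / ?nrm z * real_of_int (z j)) ` {z \<in> ?Z. ?nrm z \<noteq> 0}"
    have finZ: "finite ?Z"
      using J by (simp add: finite_PiE)
    have "card V \<le> card {z \<in> ?Z. ?nrm z \<noteq> 0}"
      unfolding V_def by (intro card_image_le finite_subset[OF _ finZ]) auto
    also have "\<dots> \<le> card ?Z"
      using finZ by (intro card_mono) auto
    finally have "real (card V) \<le> (3 * 2 ^ R) ^ card J"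
      using card_lattice_ball_le[OF J, of "R * card J" R] by linarith
    moreover have "finite V"
      unfolding V_def by (intro finite_imageI finite_subset[OF _ finZ]) auto
    moreover have "\<forall>v\<in>V. L2_set v J = 1"
      by (auto simp: V_def L2_set_cmult simp del: times_divide_eq_left) simp
    moreover have "\<exists>v\<in>V. L2_set (\<lambda>j. u j - v j) J \<le> \<delta>" if u: "L2_set u J = 1" for u
    proof -
      have "J \<noteq> {}"
        using u by auto
      \<comment> \<open>With this mesh, an error of at most \<open>\<alpha>\<close> in each
        coordinate has Euclidean length at most \<open>d\<close>.\<close>
      define \<alpha> where "\<alpha> = d / sqrt (real (card J))"
      have cJ: "real (card J) > 0"
        using J \<open>J \<noteq> {}\<close> by (simp add: card_gt_0_iff)
      have \<alpha>: "\<alpha> > 0"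
        using d cJ by (simp add: \<alpha>_def)
      have "\<forall>j. \<exists>k::int. \<bar>u j / \<alpha> - real_of_int k\<bar> \<le> 1 \<and> \<bar>real_of_int k\<bar> \<le> \<bar>u j / \<alpha>\<bar>"
        using int_round_toward_zero by blast
      then obtain k where k: "\<And>j. \<bar>u j / \<alpha> - real_of_int (k j)\<bar> \<le> 1"
          "\<And>j. \<bar>real_of_int (k j)\<bar> \<le> \<bar>u j / \<alpha>\<bar>"
        by metis
      define z where "z = restrict k J"
      have zw: "\<bar>u j - \<alpha> * z j\<bar> \<le> \<alpha>" and zu: "\<bar>\<alpha> * z j\<bar> \<le> \<bar>u j\<bar>" if "j \<in> J" for j
      proof -
        have "\<alpha> * \<bar>u j / \<alpha> - real_of_int (k j)\<bar> \<le> \<alpha> * 1"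
          using k(1) \<alpha> by (intro mult_left_mono) auto
        then have "\<bar>\<alpha> * (u j / \<alpha> - real_of_int (k j))\<bar> \<le> \<alpha>"
          using \<alpha> by (simp add: abs_mult)
        then show "\<bar>u j - \<alpha> * z j\<bar> \<le> \<alpha>"
          using \<alpha> that by (simp add: z_def right_diff_distrib)
        have "\<alpha> * \<bar>real_of_int (k j)\<bar> \<le> \<alpha> * \<bar>u j / \<alpha>\<bar>"
          using k(2) \<alpha> by (intro mult_left_mono) auto
        then show "\<bar>\<alpha> * z j\<bar> \<le> \<bar>u j\<bar>"
          using \<alpha> that by (simp add: z_def abs_mult)
      qed
      have "(L2_set (\<lambda>j. u j - \<alpha> * z j) J)\<^sup>2 \<le> (\<Sum>j\<in>J. \<alpha>\<^sup>2)"
        unfolding L2_set_power2 using zw \<alpha> by (intro sum_mono) (simp add: abs_le_square_iff[symmetric])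
      also have "\<dots> = d\<^sup>2"
        using cJ by (simp add: \<alpha>_def power_divide)
      finally have w: "L2_set (\<lambda>j. u j - \<alpha> * z j) J \<le> d"
        using d by (simp add: power2_le_iff_abs_le)
      have nz: "L2_set (\<lambda>j. \<alpha> * z j) J = \<alpha> * ?nrm z"
        using \<alpha> by (simp add: L2_set_cmult)
      have "(L2_set (\<lambda>j. \<alpha> * z j) J)\<^sup>2 \<le> (L2_set u J)\<^sup>2"
        unfolding L2_set_power2 using zu by (intro sum_mono) (simp add: abs_le_square_iff[symmetric])
      then have sq_up: "(\<alpha> * ?nrm z)\<^sup>2 \<le> 1"
        unfolding nz u by simp
      then have up: "\<alpha> * ?nrm z \<le> 1"
        by (simp add: power_le_one_iff abs_square_le_1)
      have up2: "\<alpha>\<^sup>2 * (\<Sum>j\<in>J. (real_of_int (z j))\<^sup>2) \<le> 1"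
        using sq_up by (simp add: power_mult_distrib L2_set_power2)
      have lo: "1 - d \<le> \<alpha> * ?nrm z"
        using L2_set_diff_triangle[of u J "\<lambda>j. \<alpha> * z j"] w nz u by linarith
      then have "0 < \<alpha> * ?nrm z"
        using d by linarith
      then have nz0: "?nrm z > 0"
        using \<alpha> by (simp add: zero_less_mult_iff)
      have "(\<Sum>j\<in>J. (real_of_int (z j))\<^sup>2) \<le> 1 / \<alpha>\<^sup>2"
        using up2 \<alpha> by (simp add: field_simps)
      also have "\<dots> = 1 / d\<^sup>2 * card J"
        using cJ by (simp add: \<alpha>_def power_divide)
      also have "\<dots> \<le> real R * card J"
        using R by (intro mult_right_mono) auto
      finally have sq: "(\<Sum>j\<in>J. (real_of_int (z j))\<^sup>2) \<le> R * card J"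
        by simp
      \<comment> \<open>Integrality turns the bound on the sum of squares into the bound on the sum
        of absolute values that the counting lemma asks for.\<close>
      have "\<bar>x\<bar> \<le> x\<^sup>2" for x :: int
        using self_le_power[of "\<bar>x\<bar>" 2] by (cases "x = 0") auto
      then have "(\<Sum>j\<in>J. \<bar>z j\<bar>) \<le> (\<Sum>j\<in>J. (z j)\<^sup>2)"
        by (intro sum_mono) auto
      also have "\<dots> \<le> int (R * card J)"
      proof -
        have "real_of_int (\<Sum>j\<in>J. (z j)\<^sup>2) \<le> real_of_int (int (R * card J))"
          using sq by simp
        then show ?thesis
          by (simp only: of_int_le_iff)
      qed
      finally have bd: "(\<Sum>j\<in>J. \<bar>z j\<bar>) \<le> int (R * card J)" .
      have "\<bar>z j\<bar> \<le> int (R * card J)" if "j \<in> J" for j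
        using member_le_sum[of j J "\<lambda>j. \<bar>z j\<bar>"] bd that J by force
      then have "z \<in> ?Z"
        using bd by (auto simp: z_def abs_le_iff) force+
      then have "z \<in> {z \<in> ?Z. ?nrm z \<noteq> 0}"
        using nz0 by simp
      then have inV: "(\<lambda>j. 1 / ?nrm z * real_of_int (z j)) \<in> V"
        unfolding V_def by (rule image_eqI[rotated]) (rule refl)
      have "L2_set (\<lambda>j. u j - 1 / ?nrm z * z j) J \<le> \<delta>"
      proof -
        \<comment> \<open>The total error is the rounding error plus this multiple of
          \<open>z\<close>, whose length \<open>1 - \<alpha> * ?nrm z\<close> lies between 0 and
          \<open>d\<close>.\<close>
        have "L2_set (\<lambda>j. (\<alpha> - 1 / ?nrm z) * z j) J = \<bar>\<alpha> - 1 / ?nrm z\<bar> * ?nrm z"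
          by (rule L2_set_cmult)
        also have "\<dots> = \<bar>(\<alpha> - 1 / ?nrm z) * ?nrm z\<bar>"
          by (simp add: abs_mult)
        also have "\<dots> = \<bar>\<alpha> * ?nrm z - 1\<bar>"
          using nz0 by (simp add: left_diff_distrib)
        finally have "L2_set (\<lambda>j. (\<alpha> - 1 / ?nrm z) * z j) J \<le> d"
          using lo up d by linarith
        with w L2_set_triangle_ineq[of "\<lambda>j. u j - \<alpha> * z j" "\<lambda>j. (\<alpha> - 1 / ?nrm z) * z j" J] d
        show ?thesis
          by (simp add: left_diff_distrib)
      qed
      then show ?thesis
        by (intro bexI[OF _ inV])
    qed
    ultimately show ?thesis
      by (intro exI[of _ V]) simp
  qed
  have "(3::real) * 1 \<le> 3 * 2 ^ R"
    by (intro mult_left_mono) auto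
  then have "(3::real) * 2 ^ R > 1"
    by linarith
  then show ?thesis
    using ex by (rule that)
qed

section \<open>From the net to all directions\<close>

text \<open>The squared soft threshold at level \<open>T\<close>. Soft thresholding is 1-Lipschitz,
  so a bound on the excess passes to nearby directions, which a sharp cutoff of the square would not
  allow. For large \<open>T\<close> its exponential moment is close to 1.\<close>

definition excess :: "real \<Rightarrow> real \<Rightarrow> real" where
  "excess T x = (max 0 (\<bar>x\<bar> - T))\<^sup>2"

lemma excess_nonneg: "0 \<le> excess T x"
  by (simp add: excess_def)

lemma square_le_excess: "x\<^sup>2 \<le> 2 * T\<^sup>2 + 2 * excess T x" if "T \<ge> 0"
proof -
  let ?e = "max 0 (\<bar>x\<bar> - T)"
  have "\<bar>x\<bar>\<^sup>2 \<le> (T + ?e)\<^sup>2"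
    using that by (intro power_mono) auto
  also have "\<dots> \<le> 2 * T\<^sup>2 + 2 * ?e\<^sup>2"
    using sum_squares_bound[of T ?e] by (simp add: power2_sum)
  finally show ?thesis
    by (simp add: excess_def)
qed

lemma excess_le_add_diff: "excess T x \<le> 2 * excess T y + 2 * (x - y)\<^sup>2"
proof -
  let ?e = "max 0 (\<bar>y\<bar> - T)"
  have "excess T x \<le> (?e + \<bar>x - y\<bar>)\<^sup>2"
    unfolding excess_def by (intro power_mono) auto
  also have "\<dots> \<le> 2 * ?e\<^sup>2 + 2 * \<bar>x - y\<bar>\<^sup>2"
    using sum_squares_bound[of ?e "\<bar>x - y\<bar>"] by (simp add: power2_sum)
  finally show ?thesis
    by (simp add: excess_def)
qed

lemma sum_mult_L2_set_bound: "(\<Sum>j\<in>J. f j * u j)\<^sup>2 \<le> (\<Sum>j\<in>J. (f j)\<^sup>2) * (L2_set u J)\<^sup>2"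
  by (simp add: L2_set_power2 Cauchy_Schwarz_ineq_sum)

lemma sum_mult_normalize:
  "(\<Sum>j\<in>J. f j * u j) = L2_set u J * (\<Sum>j\<in>J. f j * (1 / L2_set u J * u j))"
  if "finite J" for u :: "'j \<Rightarrow> real"
proof (cases "L2_set u J = 0")
  case True
  with that show ?thesis
    by (auto simp: L2_set_eq_0_iff)
next
  case False
  then show ?thesis
    by (simp add: sum_distrib_left)
qed

lemma L2_set_normalize: "L2_set (\<lambda>j. 1 / L2_set u J * u j) J = 1" if "L2_set u J \<noteq> 0"
  unfolding L2_set_cmult using that by simp

text \<open>A bounded quadratic form whose values on a net are at most \<open>K\<close>: comparing the supremum
  \<open>B\<close> over the sphere with the net gives \<open>B \<le> 2 * K + B / 2\<close>.\<close>

lemma net_bounds_quadratic_form: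
  fixes a :: "'i \<Rightarrow> 'j \<Rightarrow> real"
  assumes J: "finite J"
    and net: "\<And>u. L2_set u J = 1 \<Longrightarrow> \<exists>v\<in>V. L2_set (\<lambda>j. u j - v j) J \<le> 1 / 2"
    and K: "\<And>v. v \<in> V \<Longrightarrow> (\<Sum>i\<in>I. (\<Sum>j\<in>J. a i j * v j)\<^sup>2) \<le> K"
  shows "(\<Sum>i\<in>I. (\<Sum>j\<in>J. a i j * u j)\<^sup>2) \<le> 4 * K * (L2_set u J)\<^sup>2"
proof (cases "L2_set u J = 0")
  case True
  with J have "\<forall>j\<in>J. u j = 0"
    by (simp add: L2_set_eq_0_iff)
  with True show ?thesis
    by simp
next
  case False
  define Q where "Q u = (\<Sum>i\<in>I. (\<Sum>j\<in>J. a i j * u j)\<^sup>2)" for u :: "'j \<Rightarrow> real"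
  define S where "S = {u. L2_set u J = 1}"
  define B where "B = (SUP u\<in>S. Q u)"
  have "S \<noteq> {}"
    using L2_set_normalize[OF False] by (auto simp: S_def)
  \<comment> \<open>This crude Cauchy-Schwarz bound only ensures that the supremum \<open>B\<close>
    is genuine; its size does not enter the result.\<close>
  have "Q u \<le> (\<Sum>i\<in>I. \<Sum>j\<in>J. (a i j)\<^sup>2)" if "u \<in> S" for u
    unfolding Q_def using that by (intro sum_mono order_trans[OF sum_mult_L2_set_bound]) (auto simp: S_def)
  then have "bdd_above (Q ` S)"
    by (intro bdd_aboveI2)
  then have B: "Q u \<le> B" if "u \<in> S" for u
    unfolding B_def using that by (intro cSUP_upper)
  \<comment> \<open>By homogeneity \<open>B\<close> also controls the form at the difference
    \<open>u - v\<close>, which is not a unit vector.\<close>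
  have hom: "Q u \<le> B * (L2_set u J)\<^sup>2" for u
  proof (cases "L2_set u J = 0")
    case True
    with J have "\<forall>j\<in>J. u j = 0"
      by (simp add: L2_set_eq_0_iff)
    with True show ?thesis
      by (simp add: Q_def)
  next
    case False
    have "Q u = Q (\<lambda>j. 1 / L2_set u J * u j) * (L2_set u J)\<^sup>2"
      unfolding Q_def sum_mult_normalize[OF J, of _ u] power_mult_distrib
      by (subst sum_distrib_left[symmetric]) (rule mult.commute)
    also have "\<dots> \<le> B * (L2_set u J)\<^sup>2"
      using L2_set_normalize[OF False] by (intro mult_right_mono B) (auto simp: S_def)
    finally show ?thesis .
  qed
  have "Q u \<le> 2 * K + B / 2" if u: "u \<in> S" for u
  proof -
    obtain v where v: "v \<in> V" "L2_set (\<lambda>j. u j - v j) J \<le> 1 / 2"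
      using net u by (auto simp: S_def)
    let ?w = "\<lambda>j. u j - v j"
    have "Q u \<le> (\<Sum>i\<in>I. 2 * (\<Sum>j\<in>J. a i j * v j)\<^sup>2 + 2 * (\<Sum>j\<in>J. a i j * ?w j)\<^sup>2)"
      unfolding Q_def
    proof (intro sum_mono)
      fix i
      have "(x + y)\<^sup>2 \<le> 2 * x\<^sup>2 + 2 * y\<^sup>2" for x y :: real
        using sum_squares_bound[of x y] by (simp add: power2_sum)
      from this[of "\<Sum>j\<in>J. a i j * v j" "\<Sum>j\<in>J. a i j * ?w j"]
      show "(\<Sum>j\<in>J. a i j * u j)\<^sup>2 \<le> 2 * (\<Sum>j\<in>J. a i j * v j)\<^sup>2 + 2 * (\<Sum>j\<in>J. a i j * ?w j)\<^sup>2"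
        by (simp add: right_diff_distrib sum_subtractf)
    qed
    also have "\<dots> = 2 * Q v + 2 * Q ?w"
      by (simp add: Q_def sum.distrib sum_distrib_left)
    also have "Q ?w \<le> B * (L2_set ?w J)\<^sup>2"
      by (rule hom)
    also have "\<dots> \<le> B * (1 / 2)\<^sup>2"
    proof (intro mult_left_mono power_mono v)
      have "0 \<le> Q u"
        by (simp add: Q_def sum_nonneg)
      then show "0 \<le> B"
        using B[OF u] by linarith
    qed simp
    also have "Q v \<le> K"
      unfolding Q_def by (rule K[OF v(1)])
    finally show ?thesis
      by (simp add: power2_eq_square)
  qed
  then have "B \<le> 2 * K + B / 2"
    unfolding B_def using \<open>S \<noteq> {}\<close> by (intro cSUP_least)
  then have "B \<le> 4 * K"
    by simp
  then have "B * (L2_set u J)\<^sup>2 \<le> 4 * K * (L2_set u J)\<^sup>2"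
    by (intro mult_right_mono) auto
  with hom[of u] show ?thesis
    by (simp add: Q_def)
qed

text \<open>The sets \<open>S\<close> are arbitrary so that the corrupted rows may depend on the
  matrix. The strict inequality makes the first count vanish when \<open>u\<close> is zero on
  \<open>{..<n}\<close>, so no direction has to be excluded.\<close>

definition well_spread :: "real \<Rightarrow> real \<Rightarrow> real \<Rightarrow> nat \<Rightarrow> nat \<Rightarrow> (nat \<Rightarrow> nat \<Rightarrow> real) \<Rightarrow> bool" where
  "well_spread \<epsilon> \<eta> s m n a \<longleftrightarrow> (\<forall>u.
     real (card {i. i < m \<and> \<bar>\<Sum>j<n. a i j * u j\<bar> < \<epsilon> * L2_set u {..<n}}) \<le> real m / 4 \<and>
     (\<forall>S\<subseteq>{..<m}. real (card S) \<le> s * real m \<longrightarrow>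
        (\<Sum>i\<in>S. (\<Sum>j<n. a i j * u j)\<^sup>2) \<le> \<eta> * real m * (L2_set u {..<n})\<^sup>2))"

text \<open>Values at a unit vector differ from those at a near net point by the values at the
  difference, whose squares sum to at most \<open>\<delta>\<^sup>2 * K * m\<close>. Lowering the
  threshold from \<open>2 * \<epsilon>\<close> to \<open>\<epsilon>\<close> therefore costs at most
  \<open>m / 8\<close> rows, and sums over few rows are bounded by truncation at \<open>T\<close>
  plus the excess inherited from the net point.\<close>

lemma well_spread_if_on_net:
  fixes a :: "nat \<Rightarrow> nat \<Rightarrow> real"
  assumes \<epsilon>: "0 < \<epsilon>" and \<eta>: "0 < \<eta>" and T: "0 < T" and s: "s = \<eta> / (8 * T\<^sup>2)"
    and K: "K = 8 * T\<^sup>2 + \<eta> / 2"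
    and \<delta>: "0 < \<delta>" "\<delta> \<le> 1 / 2" "\<delta>\<^sup>2 * K \<le> \<eta> / 16" "\<delta>\<^sup>2 * K \<le> \<epsilon>\<^sup>2 / 8"
    and net: "\<And>u. L2_set u {..<n} = 1 \<Longrightarrow> \<exists>v\<in>V. L2_set (\<lambda>j. u j - v j) {..<n} \<le> \<delta>"
    and small: "\<And>v. v \<in> V \<Longrightarrow>
       real (card {i. i < m \<and> \<bar>\<Sum>j<n. a i j * v j\<bar> < 2 * \<epsilon>}) \<le> real m / 8"
    and large: "\<And>v. v \<in> V \<Longrightarrow> (\<Sum>i<m. excess T (\<Sum>j<n. a i j * v j)) \<le> \<eta> / 16 * real m"
  shows "well_spread \<epsilon> \<eta> s m n a"
proof -
  let ?L = "\<lambda>u i. \<Sum>j<n. a i j * u j"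
  have diff: "?L (\<lambda>j. u j - v j) i = ?L u i - ?L v i" for u v i
    by (simp add: right_diff_distrib sum_subtractf)
  \<comment> \<open>The bound on the operator norm. On the net the form is at most
    \<open>2 * T\<^sup>2 + \<eta> / 8\<close> per row on average, and this is
    \<open>K / 4\<close>.\<close>
  have gram: "(\<Sum>i<m. (?L u i)\<^sup>2) \<le> K * real m * (L2_set u {..<n})\<^sup>2" for u
  proof -
    have "(\<Sum>i<m. (?L u i)\<^sup>2) \<le> 4 * (K / 4 * real m) * (L2_set u {..<n})\<^sup>2"
    proof (rule net_bounds_quadratic_form)
      show "\<exists>v\<in>V. L2_set (\<lambda>j. u j - v j) {..<n} \<le> 1 / 2" if "L2_set u {..<n} = 1" for u
        using net[OF that] \<delta> by force
      show "(\<Sum>i<m. (?L v i)\<^sup>2) \<le> K / 4 * real m" if "v \<in> V" for v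
      proof -
        have "(\<Sum>i<m. (?L v i)\<^sup>2) \<le> (\<Sum>i<m. 2 * T\<^sup>2 + 2 * excess T (?L v i))"
          using T by (intro sum_mono square_le_excess) auto
        also have "\<dots> = 2 * T\<^sup>2 * real m + 2 * (\<Sum>i<m. excess T (?L v i))"
          by (simp add: sum.distrib sum_distrib_left)
        finally show ?thesis
          using large[OF that] by (simp add: K algebra_simps)
      qed
    qed simp
    then show ?thesis
      by simp
  qed
  have unit: "real (card {i. i < m \<and> \<bar>?L u i\<bar> < \<epsilon>}) \<le> real m / 4 \<and>
     (\<forall>S\<subseteq>{..<m}. real (card S) \<le> s * real m \<longrightarrow> (\<Sum>i\<in>S. (?L u i)\<^sup>2) \<le> \<eta> * real m)"
    if u: "L2_set u {..<n} = 1" for u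
  proof -
    obtain v where v: "v \<in> V" "L2_set (\<lambda>j. u j - v j) {..<n} \<le> \<delta>"
      using net[OF u] by blast
    let ?w = "\<lambda>j. u j - v j"
    have "(\<Sum>i<m. (?L ?w i)\<^sup>2) \<le> K * real m * (L2_set ?w {..<n})\<^sup>2"
      by (rule gram)
    also have "\<dots> \<le> K * real m * \<delta>\<^sup>2"
      using v(2) \<eta> by (intro mult_left_mono power_mono) (auto simp: K)
    finally have w: "(\<Sum>i<m. (?L ?w i)\<^sup>2) \<le> \<delta>\<^sup>2 * K * real m"
      by (simp add: mult_ac)
    have "real (card {i. i < m \<and> \<bar>?L u i\<bar> < \<epsilon>}) \<le> real m / 4"
    proof -
      let ?far = "{i. i < m \<and> \<epsilon> \<le> \<bar>?L ?w i\<bar>}"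
      \<comment> \<open>Markov's inequality for the counting measure on the rows.\<close>
      have "real (card ?far) * \<epsilon>\<^sup>2 = (\<Sum>i\<in>?far. \<epsilon>\<^sup>2)"
        by simp
      also have "\<dots> \<le> (\<Sum>i\<in>?far. (?L ?w i)\<^sup>2)"
        using \<epsilon> by (intro sum_mono) (simp add: abs_le_square_iff[symmetric])
      also have "\<dots> \<le> (\<Sum>i<m. (?L ?w i)\<^sup>2)"
        by (intro sum_mono2) auto
      also have "\<dots> \<le> \<epsilon>\<^sup>2 / 8 * real m"
        using w \<delta>(4) by (meson mult_right_mono of_nat_0_le_iff order_trans)
      also have "\<dots> = real m / 8 * \<epsilon>\<^sup>2"
        by simp
      finally have far: "real (card ?far) \<le> real m / 8"
        using \<epsilon> by (subst (asm) mult_le_cancel_right_pos) auto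
      have "card {i. i < m \<and> \<bar>?L u i\<bar> < \<epsilon>} \<le> card ({i. i < m \<and> \<bar>?L v i\<bar> < 2 * \<epsilon>} \<union> ?far)"
        unfolding diff by (intro card_mono) auto
      also have "\<dots> \<le> card {i. i < m \<and> \<bar>?L v i\<bar> < 2 * \<epsilon>} + card ?far"
        by (rule card_Un_le)
      finally show ?thesis
        using small[OF v(1)] far by linarith
    qed
    moreover have "(\<Sum>i\<in>S. (?L u i)\<^sup>2) \<le> \<eta> * real m"
      if S: "S \<subseteq> {..<m}" "real (card S) \<le> s * real m" for S
    proof -
      have "(\<Sum>i\<in>S. (?L u i)\<^sup>2) \<le> (\<Sum>i\<in>S. 2 * T\<^sup>2 + 2 * excess T (?L u i))"
        using T by (intro sum_mono square_le_excess) auto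
      also have "\<dots> = 2 * T\<^sup>2 * real (card S) + 2 * (\<Sum>i\<in>S. excess T (?L u i))"
        by (simp add: sum.distrib sum_distrib_left)
      also have "(\<Sum>i\<in>S. excess T (?L u i)) \<le> (\<Sum>i<m. excess T (?L u i))"
        using S by (intro sum_mono2) (auto simp: excess_nonneg)
      also have "\<dots> \<le> (\<Sum>i<m. 2 * excess T (?L v i) + 2 * (?L ?w i)\<^sup>2)"
        unfolding diff by (intro sum_mono excess_le_add_diff)
      also have "\<dots> = 2 * (\<Sum>i<m. excess T (?L v i)) + 2 * (\<Sum>i<m. (?L ?w i)\<^sup>2)"
        by (simp add: sum.distrib sum_distrib_left)
      also have "2 * T\<^sup>2 * real (card S) \<le> 2 * T\<^sup>2 * (s * real m)"
        using S by (intro mult_left_mono) auto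
      also have "\<dots> = \<eta> / 4 * real m"
        using T by (simp add: s)
      finally have "(\<Sum>i\<in>S. (?L u i)\<^sup>2) \<le> \<eta> / 4 * real m +
          2 * (2 * (\<Sum>i<m. excess T (?L v i)) + 2 * (\<Sum>i<m. (?L ?w i)\<^sup>2))"
        by simp
      \<comment> \<open>Truncation level, excess at \<open>v\<close> and the values at
        \<open>?w\<close> contribute at most \<open>\<eta> / 4 * m\<close> each, so the total stays
        below \<open>\<eta> * m\<close>.\<close>
      moreover have "\<delta>\<^sup>2 * K * real m \<le> \<eta> / 16 * real m"
        using \<delta>(3) by (intro mult_right_mono) auto
      moreover have "0 \<le> \<eta> * real m"
        using \<eta> by simp
      ultimately show ?thesis
        using large[OF v(1)] w by simp
    qed
    ultimately show ?thesis
      by blast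
  qed
  \<comment> \<open>Both conditions are homogeneous in \<open>u\<close>, so rescaling reduces them
    to unit vectors.\<close>
  show ?thesis
    unfolding well_spread_def
  proof (rule allI)
    fix u :: "nat \<Rightarrow> real"
    let ?c = "L2_set u {..<n}"
    show "real (card {i. i < m \<and> \<bar>?L u i\<bar> < \<epsilon> * ?c}) \<le> real m / 4 \<and>
      (\<forall>S\<subseteq>{..<m}. real (card S) \<le> s * real m \<longrightarrow> (\<Sum>i\<in>S. (?L u i)\<^sup>2) \<le> \<eta> * real m * ?c\<^sup>2)"
    proof (cases "?c = 0")
      case True
      then have "\<forall>j<n. u j = 0"
        by (simp add: L2_set_eq_0_iff)
      with True show ?thesis
        by simp
    next
      case False
      then have "?c > 0"
        by (simp add: order_less_le)
      define c where "c = ?c"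
      define y where "y i = (\<Sum>j<n. a i j * (1 / c * u j))" for i
      have "?L u i = c * y i" for i
        unfolding y_def c_def by (rule sum_mult_normalize) simp
      moreover have "{i. i < m \<and> \<bar>c * y i\<bar> < \<epsilon> * c} = {i. i < m \<and> \<bar>y i\<bar> < \<epsilon>}"
        using \<open>?c > 0\<close> unfolding abs_mult c_def[symmetric] by (auto simp: mult.commute[of \<epsilon>])
      moreover have "(\<Sum>i\<in>S. (c * y i)\<^sup>2) = (\<Sum>i\<in>S. (y i)\<^sup>2) * c\<^sup>2" for S
        by (simp add: power_mult_distrib sum_distrib_left mult.commute)
      ultimately show ?thesis
        using unit[OF L2_set_normalize[OF False]] unfolding c_def[symmetric] y_def[symmetric]
        by (simp add: mult_right_mono)
    qed
  qed
qed

section \<open>Gaussian concentration\<close>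

lemma nn_integral_std_normal: "(\<integral>\<^sup>+x. ennreal (std_normal_density x) \<partial>lborel) = 1"
  by (subst nn_integral_eq_integral) auto

text \<open>The factor widens the Gaussian: the exponent becomes \<open>- x\<^sup>2 / 8\<close>,
  which belongs to standard deviation 2, and the normalising constants differ by a factor 2.\<close>

lemma nn_integral_std_normal_exp_square:
  "(\<integral>\<^sup>+x. ennreal (std_normal_density x * exp (3 / 8 * x\<^sup>2)) \<partial>lborel) = 2"
proof -
  have "sqrt 8 = 2 * sqrt 2"
    using real_sqrt_mult[of 4 2] by simp
  then have "std_normal_density x * exp (3 / 8 * x\<^sup>2) = 2 * normal_density 0 2 x" for x
    by (simp add: normal_density_def real_sqrt_mult flip: exp_add)
  then have "(\<integral>\<^sup>+x. ennreal (std_normal_density x * exp (3 / 8 * x\<^sup>2)) \<partial>lborel)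
      = (\<integral>\<^sup>+x. ennreal (2 * normal_density 0 2 x) \<partial>lborel)"
    by simp
  also have "\<dots> = ennreal (\<integral>x. 2 * normal_density 0 2 x \<partial>lborel)"
    by (intro nn_integral_eq_integral) auto
  finally show ?thesis
    by simp
qed

text \<open>The density is at most 1, so the interval of length \<open>4 * \<epsilon>\<close> has
  mass at most \<open>4 * \<epsilon>\<close>; outside it the exponential equals 1.\<close>

lemma std_normal_small_moment:
  assumes "0 < \<epsilon>"
  shows "(\<integral>\<^sup>+x. ennreal (std_normal_density x * exp (8 * indicator {y. \<bar>y\<bar> < 2 * \<epsilon>} x)) \<partial>lborel)
    \<le> ennreal (1 + exp 8 * (4 * \<epsilon>))"
proof -
  have dens: "std_normal_density x \<le> 1" for x
  proof -
    have "1 \<le> sqrt (2 * pi)"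
      using pi_gt3 by (simp add: real_le_rsqrt)
    then have "exp (- x\<^sup>2 / 2) \<le> sqrt (2 * pi)"
      by (rule order_trans[rotated]) simp
    then show ?thesis
      using pi_gt_zero by (simp add: std_normal_density_def field_simps)
  qed
  have pw: "ennreal (std_normal_density x * exp (8 * indicator {y. \<bar>y\<bar> < 2 * \<epsilon>} x))
      \<le> ennreal (std_normal_density x) + ennreal (exp 8) * indicator {-2 * \<epsilon>..2 * \<epsilon>} x" for x
  proof (cases "\<bar>x\<bar> < 2 * \<epsilon>")
    case True
    have "std_normal_density x * exp 8 \<le> 1 * exp 8"
      using dens by (intro mult_right_mono) auto
    then have "ennreal (std_normal_density x * exp 8) \<le> ennreal (exp 8)"
      by (intro ennreal_leI) simp
    also have "\<dots> \<le> ennreal (std_normal_density x) + ennreal (exp 8)"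
      by simp
    finally show ?thesis
      using True by (simp add: abs_less_iff)
  qed simp
  have "(\<integral>\<^sup>+x. ennreal (std_normal_density x * exp (8 * indicator {y. \<bar>y\<bar> < 2 * \<epsilon>} x)) \<partial>lborel)
    \<le> (\<integral>\<^sup>+x. ennreal (std_normal_density x) + ennreal (exp 8) * indicator {-2 * \<epsilon>..2 * \<epsilon>} x \<partial>lborel)"
    by (intro nn_integral_mono pw)
  also have "\<dots> = 1 + ennreal (exp 8) * ennreal (4 * \<epsilon>)"
    using assms by (subst nn_integral_add) (auto simp: nn_integral_std_normal nn_integral_cmult_indicator)
  also have "\<dots> = ennreal (1 + exp 8 * (4 * \<epsilon>))"
    using assms by (simp add: ennreal_plus ennreal_mult)
  finally show ?thesis .
qed

text \<open>Beyond \<open>T\<close> the excess is at most \<open>x\<^sup>2\<close>. Adding the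
  nonnegative term \<open>(x\<^sup>2 - T\<^sup>2) / 8\<close> to a quarter of it gives an exponent
  with an integrable main part and the gain \<open>- T\<^sup>2 / 8\<close>.\<close>

lemma std_normal_excess_moment:
  assumes "0 < T"
  shows "(\<integral>\<^sup>+x. ennreal (std_normal_density x * exp (excess T x / 4)) \<partial>lborel)
    \<le> ennreal (1 + 2 * exp (- T\<^sup>2 / 8))"
proof -
  have pw: "exp (excess T x / 4) \<le> 1 + exp (- T\<^sup>2 / 8) * exp (3 / 8 * x\<^sup>2)" for x
  proof (cases "\<bar>x\<bar> \<le> T")
    case True
    then show ?thesis
      by (simp add: excess_def)
  next
    case False
    have "excess T x \<le> \<bar>x\<bar>\<^sup>2"
      unfolding excess_def using assms False by (intro power_mono) auto
    moreover have "T\<^sup>2 \<le> \<bar>x\<bar>\<^sup>2"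
      using assms False by (intro power_mono) auto
    ultimately have "excess T x / 4 \<le> - T\<^sup>2 / 8 + 3 / 8 * x\<^sup>2"
      by simp
    then have "exp (excess T x / 4) \<le> exp (- T\<^sup>2 / 8 + 3 / 8 * x\<^sup>2)"
      by simp
    then show ?thesis
      unfolding exp_add by linarith
  qed
  have pw': "ennreal (std_normal_density x * exp (excess T x / 4)) \<le> ennreal (std_normal_density x)
      + ennreal (exp (- T\<^sup>2 / 8)) * ennreal (std_normal_density x * exp (3 / 8 * x\<^sup>2))" for x
  proof -
    have "std_normal_density x * exp (excess T x / 4)
      \<le> std_normal_density x * (1 + exp (- T\<^sup>2 / 8) * exp (3 / 8 * x\<^sup>2))"
      by (intro mult_left_mono pw) auto
    also have "\<dots> = std_normal_density x + exp (- T\<^sup>2 / 8) * (std_normal_density x * exp (3 / 8 * x\<^sup>2))"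
      by (simp add: algebra_simps)
    finally show ?thesis
      by (simp add: ennreal_leI flip: ennreal_plus ennreal_mult)
  qed
  have "(\<integral>\<^sup>+x. ennreal (std_normal_density x * exp (excess T x / 4)) \<partial>lborel)
    \<le> (\<integral>\<^sup>+x. ennreal (std_normal_density x)
      + ennreal (exp (- T\<^sup>2 / 8)) * ennreal (std_normal_density x * exp (3 / 8 * x\<^sup>2)) \<partial>lborel)"
    by (intro nn_integral_mono pw')
  also have "\<dots> = 1 + ennreal (exp (- T\<^sup>2 / 8)) * 2"
    by (subst nn_integral_add)
      (auto simp: nn_integral_std_normal nn_integral_cmult nn_integral_std_normal_exp_square[simplified])
  also have "\<dots> = ennreal (1 + 2 * exp (- T\<^sup>2 / 8))"
    by (simp add: ennreal_plus ennreal_mult mult.commute)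
  finally show ?thesis .
qed

text \<open>Markov's inequality for the exponential of the sum, whose expectation factorises by
  independence. Working with integrals in \<open>ennreal\<close> avoids integrability
  conditions.\<close>

lemma (in prob_space) std_normal_Chernoff:
  fixes X :: "'i \<Rightarrow> 'a \<Rightarrow> real" and \<phi> :: "real \<Rightarrow> real"
  assumes I: "finite I" and indep: "indep_vars (\<lambda>_. borel) X I"
    and normal: "\<And>i. i \<in> I \<Longrightarrow> distributed M lborel (X i) std_normal_density"
    and \<phi>[measurable]: "\<phi> \<in> borel_measurable borel"
    and R: "0 \<le> R" "(\<integral>\<^sup>+x. ennreal (std_normal_density x * exp (\<phi> x)) \<partial>lborel) \<le> ennreal R"
  shows "prob {\<omega> \<in> space M. real (card I) * t < (\<Sum>i\<in>I. \<phi> (X i \<omega>))} \<le> (R * exp (- t)) ^ card I"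
proof -
  have [measurable]: "random_variable borel (X i)" if "i \<in> I" for i
    using indep that by (auto simp: indep_vars_def)
  define Y where "Y i \<omega> = ennreal (exp (\<phi> (X i \<omega>)))" for i \<omega>
  have [measurable]: "Y i \<in> borel_measurable M" if "i \<in> I" for i
    unfolding Y_def using that by measurable
  have Y: "(\<Prod>i\<in>I. Y i \<omega>) = ennreal (exp (\<Sum>i\<in>I. \<phi> (X i \<omega>)))" for \<omega>
    using I by (simp add: Y_def prod_ennreal exp_sum)
  have mom: "(\<integral>\<^sup>+\<omega>. Y i \<omega> \<partial>M) \<le> ennreal R" if "i \<in> I" for i
  proof -
    have "(\<integral>\<^sup>+\<omega>. Y i \<omega> \<partial>M) = (\<integral>\<^sup>+x. ennreal (std_normal_density x) * ennreal (exp (\<phi> x)) \<partial>lborel)"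
      unfolding Y_def by (rule distributed_nn_integral[OF normal[OF that], symmetric]) simp
    also have "\<dots> \<le> ennreal R"
      using R by (simp add: ennreal_mult)
    finally show ?thesis .
  qed
  let ?B = "{\<omega> \<in> space M. real (card I) * t < (\<Sum>i\<in>I. \<phi> (X i \<omega>))}"
  let ?c = "ennreal (exp (- (real (card I) * t)))"
  have "emeasure M ?B \<le> emeasure M {\<omega> \<in> space M. 1 \<le> ?c * (\<Prod>i\<in>I. Y i \<omega>)}"
    unfolding Y by (intro emeasure_mono) (auto simp flip: ennreal_mult exp_add)
  also have "\<dots> \<le> ?c * (\<integral>\<^sup>+\<omega>. (\<Prod>i\<in>I. Y i \<omega>) * indicator (space M) \<omega> \<partial>M)"
  proof -
    have "{\<omega> \<in> space M. 1 \<le> ?c * (\<Prod>i\<in>I. Y i \<omega>)} = {\<omega> \<in> space M. 1 \<le> ?c * (\<Prod>i\<in>I. Y i \<omega>)} \<inter> space M"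
      by auto
    then show ?thesis
      by (intro nn_integral_Markov_inequality) auto
  qed
  also have "(\<integral>\<^sup>+\<omega>. (\<Prod>i\<in>I. Y i \<omega>) * indicator (space M) \<omega> \<partial>M) = (\<integral>\<^sup>+\<omega>. (\<Prod>i\<in>I. Y i \<omega>) \<partial>M)"
    by (intro nn_integral_cong) simp
  also have "\<dots> = (\<Prod>i\<in>I. \<integral>\<^sup>+\<omega>. Y i \<omega> \<partial>M)"
    unfolding Y_def by (intro indep_vars_nn_integral I indep_vars_compose2[OF indep]) auto
  also have "\<dots> \<le> (\<Prod>i\<in>I. ennreal R)"
    by (intro prod_mono_ennreal mom)
  also have "?c * (\<Prod>i\<in>I. ennreal R) = ?c * ennreal (R ^ card I)"
    using R by (simp add: ennreal_power)
  also have "\<dots> = ennreal (exp (- (real (card I) * t)) * R ^ card I)"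
    using R by (intro ennreal_mult[symmetric]) auto
  also have "exp (- (real (card I) * t)) = exp (- t) ^ card I"
    by (simp flip: exp_of_nat_mult)
  also have "\<dots> * R ^ card I = (R * exp (- t)) ^ card I"
    by (simp add: power_mult_distrib)
  finally show ?thesis
    using R by (simp add: emeasure_eq_measure mult_left_mono)
qed

text \<open>Different rows use disjoint blocks of an independent family.\<close>

lemma (in prob_space) indep_vars_linear_rows:
  fixes X :: "'i \<times> 'j \<Rightarrow> 'a \<Rightarrow> real"
  assumes "indep_vars (\<lambda>_. borel) X (I \<times> J)"
  shows "indep_vars (\<lambda>_. borel) (\<lambda>i \<omega>. \<Sum>j\<in>J. X (i, j) \<omega> * v j) I"
proof -
  have "indep_vars (\<lambda>i. PiM ({i} \<times> J) (\<lambda>_. borel)) (\<lambda>i \<omega>. restrict (\<lambda>k. X k \<omega>) ({i} \<times> J)) I"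
    using assms by (rule indep_vars_restrict) (auto simp: disjoint_family_on_def)
  then have "indep_vars (\<lambda>_. borel)
      (\<lambda>i \<omega>. \<Sum>j\<in>J. restrict (\<lambda>k. X k \<omega>) ({i} \<times> J) (i, j) * v j) I"
    by (rule indep_vars_compose2[where Y = "\<lambda>i f. \<Sum>j\<in>J. f (i, j) * v j"]) measurable
  then show ?thesis
    by simp
qed

text \<open>Stability of the normal law: the variances \<open>(v j)\<^sup>2\<close> add up to
  1.\<close>

lemma (in prob_space) distributed_unit_combination:
  fixes X :: "'j \<Rightarrow> 'a \<Rightarrow> real"
  assumes J: "finite J" and indep: "indep_vars (\<lambda>_. borel) X J"
    and normal: "\<And>j. j \<in> J \<Longrightarrow> distributed M lborel (X j) std_normal_density"
    and v: "L2_set v J = 1"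
  shows "distributed M lborel (\<lambda>\<omega>. \<Sum>j\<in>J. X j \<omega> * v j) std_normal_density"
proof -
  \<comment> \<open>Coordinates with \<open>v j = 0\<close> are dropped, as their products have no density.\<close>
  let ?J = "{j \<in> J. v j \<noteq> 0}"
  have J0: "?J \<noteq> {}"
  proof
    assume "?J = {}"
    then have "L2_set v J = 0"
      by (intro L2_set_0') auto
    with v show False
      by simp
  qed
  have "indep_vars (\<lambda>_. borel) X ?J"
    by (rule indep_vars_subset[OF indep]) auto
  then have ind: "indep_vars (\<lambda>_. borel) (\<lambda>j \<omega>. X j \<omega> * v j) ?J"
    by (rule indep_vars_compose2) simp
  have "distributed M lborel (\<lambda>\<omega>. X j \<omega> * v j) (normal_density 0 \<bar>v j\<bar>)" if "j \<in> ?J" for j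
    using normal_density_affine[of "X j" 0 1 "v j" 0] normal[of j] that by (simp add: mult.commute)
  with J0 ind J have "distributed M lborel (\<lambda>\<omega>. \<Sum>j\<in>?J. X j \<omega> * v j)
      (normal_density (\<Sum>j\<in>?J. 0) (sqrt (\<Sum>j\<in>?J. \<bar>v j\<bar>\<^sup>2)))"
    by (intro sum_indep_normal) auto
  moreover have "(\<Sum>j\<in>?J. X j \<omega> * v j) = (\<Sum>j\<in>J. X j \<omega> * v j)" for \<omega>
    using J by (intro sum.mono_neutral_left) auto
  moreover have "(\<Sum>j\<in>?J. \<bar>v j\<bar>\<^sup>2) = (\<Sum>j\<in>J. (v j)\<^sup>2)"
    using J by (intro sum.mono_neutral_cong_left) auto
  ultimately show ?thesis
    using v by (simp add: L2_set_def)
qed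

text \<open>The constants are fixed in the order \<open>\<epsilon>\<close>, \<open>\<eta>\<close>,
  \<open>T\<close>, \<open>\<delta>\<close>, and only then the net, whose growth factor
  \<open>N\<close> may thus depend on all of them; \<open>c0\<close> compensates for its
  size.\<close>

lemma gaussian_well_spread:
  obtains \<epsilon> s c0 c1 :: real where "0 < \<epsilon>" "0 < s" "s \<le> 1 / 4" "0 < c0" "0 < c1"
    "\<And>m n (M :: 'w measure) A. iid_gaussian_matrix M m n A \<Longrightarrow> c0 * real n \<le> real m \<Longrightarrow>
       \<exists>E\<in>sets M. 1 - 2 * exp (- c1 * real m) \<le> measure M E \<and>
         (\<forall>\<omega>\<in>E. well_spread \<epsilon> (\<epsilon>\<^sup>2 / 16) s m n (\<lambda>i j. A \<omega> $$ (i, j)))"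
proof -
  \<comment> \<open>Chosen so that the moment bound \<open>R1\<close> equals \<open>3 / 2\<close>,
    which is below \<open>exp 1\<close>.\<close>
  define \<epsilon> :: real where "\<epsilon> = exp (- 8) / 8"
  define \<eta> where "\<eta> = \<epsilon>\<^sup>2 / 16"
  \<comment> \<open>The slack for the tail moment: \<open>R2 < exp (\<eta> / 64)\<close> means
    \<open>2 * exp (- T\<^sup>2 / 8) < \<kappa>\<close>, which the choice of \<open>T\<close>
    achieves through \<open>1 + x \<le> exp x\<close>.\<close>
  define \<kappa> where "\<kappa> = exp (\<eta> / 64) - 1"
  define T where "T = max 1 (16 / \<kappa>)"
  define s where "s = \<eta> / (8 * T\<^sup>2)"
  define K where "K = 8 * T\<^sup>2 + \<eta> / 2"
  define \<delta> where "\<delta> = min (1 / 2) (sqrt (min (\<eta> / 16) (\<epsilon>\<^sup>2 / 8) / K))"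
  have \<epsilon>: "0 < \<epsilon>" "\<epsilon> < 1"
  proof -
    have "exp (- 8) \<le> (1::real)"
      by simp
    then have "exp (- 8) < (8::real)"
      by linarith
    then show "0 < \<epsilon>" "\<epsilon> < 1"
      unfolding \<epsilon>_def by auto
  qed
  have "\<epsilon>\<^sup>2 \<le> 1"
    using \<epsilon> by (simp add: power_le_one)
  then have \<eta>: "0 < \<eta>" "\<eta> \<le> 1"
    using \<epsilon> by (auto simp: \<eta>_def)
  have \<kappa>: "0 < \<kappa>"
    using \<eta> by (simp add: \<kappa>_def)
  have T: "1 \<le> T" "16 / \<kappa> \<le> T"
    by (auto simp: T_def)
  have T2: "1 \<le> T\<^sup>2" "T \<le> T\<^sup>2"
    using T self_le_power[of T 2] by (auto simp: one_le_power)
  have s: "0 < s" "s \<le> 1 / 4"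
    using \<eta> T2 T by (auto simp: s_def divide_simps)
  have K: "0 < K"
    using \<eta> T2 by (simp add: K_def)
  have \<delta>: "0 < \<delta>" "\<delta> \<le> 1 / 2" "\<delta>\<^sup>2 * K \<le> \<eta> / 16" "\<delta>\<^sup>2 * K \<le> \<epsilon>\<^sup>2 / 8"
  proof -
    have pos: "0 < min (\<eta> / 16) (\<epsilon>\<^sup>2 / 8) / K"
      using \<eta> \<epsilon> K by simp
    then show d: "0 < \<delta>" "\<delta> \<le> 1 / 2"
      by (auto simp: \<delta>_def)
    have "\<delta>\<^sup>2 \<le> (sqrt (min (\<eta> / 16) (\<epsilon>\<^sup>2 / 8) / K))\<^sup>2"
      using d by (intro power_mono) (auto simp: \<delta>_def)
    also have "\<dots> = min (\<eta> / 16) (\<epsilon>\<^sup>2 / 8) / K"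
      using pos by simp
    finally have "\<delta>\<^sup>2 * K \<le> min (\<eta> / 16) (\<epsilon>\<^sup>2 / 8)"
      using K by (simp add: pos_le_divide_eq)
    then show "\<delta>\<^sup>2 * K \<le> \<eta> / 16" "\<delta>\<^sup>2 * K \<le> \<epsilon>\<^sup>2 / 8"
      by auto
  qed
  define R1 :: real where "R1 = 1 + exp 8 * (4 * \<epsilon>)"
  define R2 where "R2 = 1 + 2 * exp (- T\<^sup>2 / 8)"
  define \<rho> where "\<rho> = max (R1 * exp (- 1)) (R2 * exp (- (\<eta> / 64)))"
  have R: "0 \<le> R1" "0 \<le> R2" "0 < R2"
    using \<epsilon> by (auto simp: R1_def R2_def add_pos_pos)
  have "R1 = 3 / 2"
    by (simp add: R1_def \<epsilon>_def flip: exp_add)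
  moreover have "(2::real) \<le> exp 1"
    using exp_ge_add_one_self[of 1] by simp
  ultimately have r1: "R1 * exp (- 1) < 1"
    by (simp add: exp_minus field_simps)
  have "1 + T\<^sup>2 / 8 \<le> exp (T\<^sup>2 / 8)"
    by (rule exp_ge_add_one_self)
  moreover have "2 / \<kappa> \<le> T\<^sup>2 / 8"
    using T T2 by simp
  ultimately have "2 / \<kappa> < exp (T\<^sup>2 / 8)"
    by linarith
  then have "2 * exp (- T\<^sup>2 / 8) < \<kappa>"
    using \<kappa> by (simp add: exp_minus field_simps)
  then have r2: "R2 * exp (- (\<eta> / 64)) < 1"
    by (simp add: R2_def \<kappa>_def exp_minus field_simps)
  have \<rho>: "0 < \<rho>" "\<rho> < 1"
    using r1 r2 R by (auto simp: \<rho>_def less_max_iff_disj)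
  obtain N :: real where N: "1 < N" and net:
    "\<And>J :: nat set. finite J \<Longrightarrow> \<exists>V. finite V \<and> real (card V) \<le> N ^ card J \<and>
       (\<forall>v\<in>V. L2_set v J = 1) \<and>
       (\<forall>u. L2_set u J = 1 \<longrightarrow> (\<exists>v\<in>V. L2_set (\<lambda>j. u j - v j) J \<le> \<delta>))"
    by (rule sphere_net[OF \<delta>(1), where 'j = nat]) (rule that)
  \<comment> \<open>Half of the decay rate \<open>- ln \<rho>\<close> pays for the union bound, as
    \<open>N ^ n \<le> exp (c1 * m)\<close> once \<open>c0 * n \<le> m\<close>; the other half
    remains.\<close>
  define c1 where "c1 = - ln \<rho> / 2"
  define c0 where "c0 = ln N / c1"
  have "0 < c1"
    using \<rho> by (simp add: c1_def)
  with N have c: "0 < c0" "0 < c1"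
    by (auto simp: c0_def)
  have main: "\<exists>E\<in>sets M. 1 - 2 * exp (- c1 * real m) \<le> measure M E \<and>
         (\<forall>\<omega>\<in>E. well_spread \<epsilon> \<eta> s m n (\<lambda>i j. A \<omega> $$ (i, j)))"
    if iid: "iid_gaussian_matrix M m n A" and mn: "c0 * real n \<le> real m"
    for m n and M :: "'w measure" and A
  proof -
    interpret prob_space M
      using iid by (simp add: iid_gaussian_matrix_def)
    have indep: "indep_vars (\<lambda>_. borel) (\<lambda>ij \<omega>. A \<omega> $$ ij) ({..<m} \<times> {..<n})"
      and normal: "\<And>ij. ij \<in> {..<m} \<times> {..<n} \<Longrightarrow>
        distributed M lborel (\<lambda>\<omega>. A \<omega> $$ ij) std_normal_density"
      using iid unfolding iid_gaussian_matrix_def by blast+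
    obtain V where V: "finite V" "real (card V) \<le> N ^ n" "\<And>v. v \<in> V \<Longrightarrow> L2_set v {..<n} = 1"
        "\<And>u. L2_set u {..<n} = 1 \<Longrightarrow> \<exists>v\<in>V. L2_set (\<lambda>j. u j - v j) {..<n} \<le> \<delta>"
      using net[of "{..<n}"] by auto
    define X where "X v i \<omega> = (\<Sum>j<n. A \<omega> $$ (i, j) * v j)" for v i \<omega>
    \<comment> \<open>The scalings match the thresholds in \<open>bad\<close>: a sum of
      \<open>\<phi>1\<close> above \<open>m\<close> means more than \<open>m / 8\<close> small
      values, and a sum of \<open>\<phi>2\<close> above \<open>\<eta> / 64 * m\<close> means a total
      excess above \<open>\<eta> / 16 * m\<close>.\<close>
    define \<phi>1 :: "real \<Rightarrow> real" where "\<phi>1 x = 8 * indicator {y. \<bar>y\<bar> < 2 * \<epsilon>} x" for x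
    define \<phi>2 :: "real \<Rightarrow> real" where "\<phi>2 x = excess T x / 4" for x
    have [measurable]: "\<phi>1 \<in> borel_measurable borel" "\<phi>2 \<in> borel_measurable borel"
      unfolding \<phi>1_def \<phi>2_def excess_def by measurable
    define bad where "bad v = {\<omega> \<in> space M. real (card {..<m}) * 1 < (\<Sum>i<m. \<phi>1 (X v i \<omega>))} \<union>
      {\<omega> \<in> space M. real (card {..<m}) * (\<eta> / 64) < (\<Sum>i<m. \<phi>2 (X v i \<omega>))}" for v
    have indX: "indep_vars (\<lambda>_. borel) (X v) {..<m}" for v
      unfolding X_def using indep_vars_linear_rows[OF indep] .
    have [measurable]: "random_variable borel (X v i)" if "i < m" for v i
      using indX[of v] that by (auto simp: indep_vars_def)
    have normX: "distributed M lborel (X v i) std_normal_density" if "v \<in> V" "i < m" for v i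
    proof -
      have row: "(\<Sum>ij\<in>Pair i ` {..<n}. f ij) = (\<Sum>j<n. f (i, j))" for f :: "nat \<times> nat \<Rightarrow> real"
        by (subst sum.reindex) (auto simp: inj_on_def)
      have "distributed M lborel (\<lambda>\<omega>. \<Sum>ij\<in>Pair i ` {..<n}. A \<omega> $$ ij * v (snd ij)) std_normal_density"
      proof (rule distributed_unit_combination)
        show "indep_vars (\<lambda>_. borel) (\<lambda>ij \<omega>. A \<omega> $$ ij) (Pair i ` {..<n})"
          using that(2) by (intro indep_vars_subset[OF indep]) auto
        show "L2_set (\<lambda>ij. v (snd ij)) (Pair i ` {..<n}) = 1"
          using V(3)[OF that(1)] by (simp add: L2_set_def row)
      qed (use that normal in auto)
      then show ?thesis
        by (simp add: X_def[abs_def] row)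
    qed
    have bad_meas: "bad v \<in> sets M" for v
      unfolding bad_def by measurable
    have bad_prob: "prob (bad v) \<le> 2 * \<rho> ^ m" if "v \<in> V" for v
    proof -
      have "prob {\<omega> \<in> space M. real (card {..<m}) * 1 < (\<Sum>i<m. \<phi>1 (X v i \<omega>))}
          \<le> (R1 * exp (- 1)) ^ card {..<m}"
        using normX[OF that] R std_normal_small_moment[OF \<epsilon>(1)]
        by (intro std_normal_Chernoff[where \<phi> = \<phi>1 and X = "X v"] indX) (auto simp: \<phi>1_def R1_def)
      also have "\<dots> \<le> \<rho> ^ m"
        using R by (auto simp: \<rho>_def intro!: power_mono)
      finally have 1: "prob {\<omega> \<in> space M. real (card {..<m}) * 1 < (\<Sum>i<m. \<phi>1 (X v i \<omega>))} \<le> \<rho> ^ m" .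
      have "prob {\<omega> \<in> space M. real (card {..<m}) * (\<eta> / 64) < (\<Sum>i<m. \<phi>2 (X v i \<omega>))}
          \<le> (R2 * exp (- (\<eta> / 64))) ^ card {..<m}"
        using normX[OF that] R std_normal_excess_moment[of T] T
        by (intro std_normal_Chernoff[where \<phi> = \<phi>2 and X = "X v"] indX) (auto simp: \<phi>2_def R2_def)
      also have "\<dots> \<le> \<rho> ^ m"
        using R by (auto simp: \<rho>_def intro!: power_mono)
      finally have 2: "prob {\<omega> \<in> space M. real (card {..<m}) * (\<eta> / 64) < (\<Sum>i<m. \<phi>2 (X v i \<omega>))} \<le> \<rho> ^ m" .
      have "prob (bad v) \<le> prob {\<omega> \<in> space M. real (card {..<m}) * 1 < (\<Sum>i<m. \<phi>1 (X v i \<omega>))}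
        + prob {\<omega> \<in> space M. real (card {..<m}) * (\<eta> / 64) < (\<Sum>i<m. \<phi>2 (X v i \<omega>))}"
        unfolding bad_def by (rule measure_Un_le) measurable
      with 1 2 show ?thesis
        by linarith
    qed
    \<comment> \<open>The net does not depend on \<open>\<omega>\<close>, so only finitely many
      events are removed.\<close>
    define E where "E = space M - (\<Union>v\<in>V. bad v)"
    have UN: "(\<Union>v\<in>V. bad v) \<in> sets M"
      using V(1) bad_meas by auto
    have "prob (\<Union>v\<in>V. bad v) \<le> (\<Sum>v\<in>V. prob (bad v))"
      using V(1) bad_meas by (intro finite_measure_subadditive_finite) auto
    also have "\<dots> \<le> real (card V) * (2 * \<rho> ^ m)"
      using bad_prob by (intro sum_bounded_above)
    also have "\<dots> \<le> N ^ n * (2 * \<rho> ^ m)"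
      using V(2) \<rho> by (intro mult_right_mono) auto
    also have "\<dots> \<le> exp (c1 * real m) * (2 * exp (- 2 * c1 * real m))"
    proof (rule mult_mono)
      have "N ^ n = exp (ln N * real n)"
        using N by (simp add: exp_of_nat2_mult)
      also have "ln N = c0 * c1"
        using c by (simp add: c0_def)
      also have "exp (c0 * c1 * real n) \<le> exp (c1 * real m)"
        using mult_left_mono[OF mn, of c1] c by (simp add: mult_ac)
      finally show "N ^ n \<le> exp (c1 * real m)" .
      have "\<rho> ^ m = exp (ln \<rho> * real m)"
        using \<rho> by (simp add: exp_of_nat2_mult)
      then show "2 * \<rho> ^ m \<le> 2 * exp (- 2 * c1 * real m)"
        by (simp add: c1_def)
    qed (use \<rho> in auto)
    also have "\<dots> = 2 * exp (- c1 * real m)"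
      by (simp flip: exp_add)
    finally have "1 - 2 * exp (- c1 * real m) \<le> prob E"
      unfolding E_def using prob_compl[OF UN] by simp
    moreover have "E \<in> sets M"
      unfolding E_def using UN by auto
    moreover have "well_spread \<epsilon> \<eta> s m n (\<lambda>i j. A \<omega> $$ (i, j))" if \<omega>: "\<omega> \<in> E" for \<omega>
    proof (rule well_spread_if_on_net[where T = T and \<delta> = \<delta> and K = K and V = V])
      fix v assume v: "v \<in> V"
      with \<omega> have not_bad: "\<omega> \<in> space M" "\<omega> \<notin> bad v"
        by (auto simp: E_def)
      have "(\<Sum>i<m. \<phi>1 (X v i \<omega>)) = (\<Sum>i\<in>{i. i < m \<and> \<bar>X v i \<omega>\<bar> < 2 * \<epsilon>}. 8)"
        unfolding \<phi>1_def by (rule sum.mono_neutral_cong_right) auto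
      then show "real (card {i. i < m \<and> \<bar>\<Sum>j<n. A \<omega> $$ (i, j) * v j\<bar> < 2 * \<epsilon>}) \<le> real m / 8"
        using not_bad by (auto simp: bad_def X_def)
      show "(\<Sum>i<m. excess T (\<Sum>j<n. A \<omega> $$ (i, j) * v j)) \<le> \<eta> / 16 * real m"
        using not_bad by (auto simp: bad_def X_def \<phi>2_def simp flip: sum_divide_distrib)
    qed (use \<epsilon> \<eta> T \<delta> V(4) in \<open>auto simp: s_def K_def\<close>)
    ultimately show ?thesis
      by blast
  qed
  show ?thesis
    using \<epsilon>(1) s c main unfolding \<eta>_def by (rule that)
qed

section \<open>Sharpness\<close>

lemma well_spread_L2_set_le:
  assumes ws: "well_spread \<epsilon> (\<epsilon>\<^sup>2 / 16) s m n a" and "0 < \<epsilon>"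
    and S: "S \<subseteq> {..<m}" "real (card S) \<le> s * real m"
  shows "L2_set (\<lambda>i. \<Sum>j<n. a i j * u j) S \<le> \<epsilon> / 4 * sqrt (real m) * L2_set u {..<n}"
proof -
  have "(\<Sum>i\<in>S. (\<Sum>j<n. a i j * u j)\<^sup>2) \<le> \<epsilon>\<^sup>2 / 16 * real m * (L2_set u {..<n})\<^sup>2"
    using ws S unfolding well_spread_def by blast
  also have "\<dots> = (\<epsilon> / 4 * sqrt (real m) * L2_set u {..<n})\<^sup>2"
    by (simp add: power_mult_distrib power_divide)
  finally have "(L2_set (\<lambda>i. \<Sum>j<n. a i j * u j) S)\<^sup>2 \<le> (\<epsilon> / 4 * sqrt (real m) * L2_set u {..<n})\<^sup>2"
    by (simp only: L2_set_power2)
  then show ?thesis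
    by (rule power2_le_imp_le) (use assms(2) in simp)
qed

text \<open>At most \<open>m / 4\<close> rows are lost to each of three sets: \<open>S\<close> and
  the rows that are small for \<open>u\<close> or for \<open>v\<close>.\<close>

lemma well_spread_common_large:
  assumes ws: "well_spread \<epsilon> \<eta> s m n a" and S: "S \<subseteq> {..<m}" "real (card S) \<le> real m / 4"
  obtains G where "G \<subseteq> {..<m} - S" "real m / 4 \<le> real (card G)"
    "\<And>i. i \<in> G \<Longrightarrow> \<epsilon> * L2_set u {..<n} \<le> \<bar>\<Sum>j<n. a i j * u j\<bar>"
    "\<And>i. i \<in> G \<Longrightarrow> \<epsilon> * L2_set v {..<n} \<le> \<bar>\<Sum>j<n. a i j * v j\<bar>"
proof -
  define low where "low w = {i. i < m \<and> \<bar>\<Sum>j<n. a i j * w j\<bar> < \<epsilon> * L2_set w {..<n}}" for w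
  have low: "real (card (low w)) \<le> real m / 4" "low w \<subseteq> {..<m}" for w
    using ws by (auto simp: well_spread_def low_def)
  let ?G = "{..<m} - (S \<union> low u \<union> low v)"
  have "real (card {..<m}) - real (card (S \<union> low u \<union> low v)) \<le> real (card ?G)"
    using diff_card_le_card_Diff[of "S \<union> low u \<union> low v" "{..<m}"] finite_subset[OF S(1)]
      finite_subset[OF low(2)] by simp
  moreover have "card (S \<union> low u \<union> low v) \<le> card S + card (low u) + card (low v)"
    by (meson add_le_mono1 card_Un_le order_trans)
  ultimately have "real m / 4 \<le> real (card ?G)"
    using S(2) low(1)[of u] low(1)[of v] by simp
  moreover have "?G \<subseteq> {..<m} - S"
    by auto
  moreover have "\<epsilon> * L2_set w {..<n} \<le> \<bar>\<Sum>j<n. a i j * w j\<bar>" if "i < m" "i \<notin> low w" for i w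
    using that by (auto simp: low_def)
  ultimately show ?thesis
    by (intro that[of ?G]) auto
qed

lemma sum_ge_card_mult:
  assumes "finite B" "G \<subseteq> B" "k \<le> real (card G)" "0 \<le> c"
    and "\<And>i. i \<in> G \<Longrightarrow> c \<le> f i" and "\<And>i. i \<in> B \<Longrightarrow> 0 \<le> f i"
  shows "k * c \<le> (\<Sum>i\<in>B. f i)"
proof -
  have "k * c \<le> (\<Sum>i\<in>G. c)"
    using assms by (simp add: mult_right_mono)
  also have "\<dots> \<le> (\<Sum>i\<in>G. f i)"
    using assms by (intro sum_mono)
  also have "\<dots> \<le> (\<Sum>i\<in>B. f i)"
    using assms by (intro sum_mono2) auto
  finally show ?thesis .
qed

text \<open>Off \<open>S\<close> the common large rows give the coefficient \<open>1 / 4\<close>. On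
  \<open>S\<close>, Cauchy-Schwarz with a factor \<open>\<epsilon> / 4\<close> for each of
  \<open>u\<close> and \<open>v\<close> gives at most \<open>1 / 16\<close>.\<close>

lemma well_spread_product_gap:
  fixes a :: "nat \<Rightarrow> nat \<Rightarrow> real" and u v :: "nat \<Rightarrow> real"
  assumes ws: "well_spread \<epsilon> (\<epsilon>\<^sup>2 / 16) s m n a" and \<epsilon>: "0 < \<epsilon>" and s: "s \<le> 1 / 4"
    and S: "S \<subseteq> {..<m}" "real (card S) \<le> s * real m"
  defines "d \<equiv> \<lambda>i. \<bar>\<Sum>j<n. a i j * u j\<bar> * \<bar>\<Sum>j<n. a i j * v j\<bar>"
  shows "3 / 16 * \<epsilon>\<^sup>2 * real m * (L2_set u {..<n} * L2_set v {..<n})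
    \<le> (\<Sum>i\<in>{..<m} - S. d i) - (\<Sum>i\<in>S. d i)"
proof -
  let ?U = "L2_set u {..<n}" and ?V = "L2_set v {..<n}"
  have "s * real m \<le> 1 / 4 * real m"
    using s by (intro mult_right_mono) auto
  with S have S4: "real (card S) \<le> real m / 4"
    by simp
  obtain G where G: "G \<subseteq> {..<m} - S" "real m / 4 \<le> real (card G)"
    "\<And>i. i \<in> G \<Longrightarrow> \<epsilon> * ?U \<le> \<bar>\<Sum>j<n. a i j * u j\<bar>"
    "\<And>i. i \<in> G \<Longrightarrow> \<epsilon> * ?V \<le> \<bar>\<Sum>j<n. a i j * v j\<bar>"
    by (rule well_spread_common_large[OF ws S(1) S4, of u v]) (rule that)
  define q where "q = \<epsilon>\<^sup>2 * real m * (?U * ?V)"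
  have "real m / 4 * ((\<epsilon> * ?U) * (\<epsilon> * ?V)) \<le> (\<Sum>i\<in>{..<m} - S. d i)"
    unfolding d_def using \<epsilon> G by (intro sum_ge_card_mult[where G = G] mult_mono) auto
  moreover have "real m / 4 * ((\<epsilon> * ?U) * (\<epsilon> * ?V)) = q / 4"
    by (simp add: q_def power2_eq_square)
  moreover have "(\<Sum>i\<in>S. d i) \<le> (\<epsilon> / 4 * sqrt (real m) * ?U) * (\<epsilon> / 4 * sqrt (real m) * ?V)"
    unfolding d_def using \<epsilon>
    by (intro order_trans[OF L2_set_mult_ineq] mult_mono well_spread_L2_set_le[OF ws \<epsilon> S]) auto
  moreover have "(\<epsilon> / 4 * sqrt (real m) * ?U) * (\<epsilon> / 4 * sqrt (real m) * ?V) = q / 16"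
  proof -
    have "(\<epsilon> / 4 * sqrt (real m) * ?U) * (\<epsilon> / 4 * sqrt (real m) * ?V)
        = \<epsilon>\<^sup>2 / 16 * (sqrt (real m) * sqrt (real m)) * (?U * ?V)"
      by (simp add: power2_eq_square)
    also have "\<dots> = q / 16"
      by (simp add: q_def)
    finally show ?thesis .
  qed
  moreover have "3 / 16 * \<epsilon>\<^sup>2 * real m * (?U * ?V) = 3 / 16 * q"
    by (simp add: q_def)
  ultimately show ?thesis
    by linarith
qed

text \<open>Off \<open>S\<close> the coefficient is again \<open>1 / 4\<close>. On \<open>S\<close>,
  Cauchy-Schwarz pairs one combination with the constant 1, whose norm there is at most
  \<open>sqrt m / 2\<close>, and this gives at most \<open>1 / 8\<close>.\<close>

lemma well_spread_min_gap:
  fixes a :: "nat \<Rightarrow> nat \<Rightarrow> real" and u v :: "nat \<Rightarrow> real"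
  assumes ws: "well_spread \<epsilon> (\<epsilon>\<^sup>2 / 16) s m n a" and \<epsilon>: "0 < \<epsilon>" and s: "s \<le> 1 / 4"
    and S: "S \<subseteq> {..<m}" "real (card S) \<le> s * real m"
  defines "d \<equiv> \<lambda>i. min \<bar>\<Sum>j<n. a i j * u j\<bar> \<bar>\<Sum>j<n. a i j * v j\<bar>"
  shows "1 / 8 * \<epsilon> * real m * min (L2_set u {..<n}) (L2_set v {..<n})
    \<le> (\<Sum>i\<in>{..<m} - S. d i) - (\<Sum>i\<in>S. d i)"
proof -
  let ?U = "L2_set u {..<n}" and ?V = "L2_set v {..<n}"
  have "s * real m \<le> 1 / 4 * real m"
    using s by (intro mult_right_mono) auto
  with S have S4: "real (card S) \<le> real m / 4"
    by simp
  obtain G where G: "G \<subseteq> {..<m} - S" "real m / 4 \<le> real (card G)"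
    "\<And>i. i \<in> G \<Longrightarrow> \<epsilon> * ?U \<le> \<bar>\<Sum>j<n. a i j * u j\<bar>"
    "\<And>i. i \<in> G \<Longrightarrow> \<epsilon> * ?V \<le> \<bar>\<Sum>j<n. a i j * v j\<bar>"
    by (rule well_spread_common_large[OF ws S(1) S4, of u v]) (rule that)
  have "real m / 4 * min (\<epsilon> * ?U) (\<epsilon> * ?V) \<le> (\<Sum>i\<in>{..<m} - S. d i)"
    unfolding d_def using \<epsilon> G by (intro sum_ge_card_mult[where G = G] min.mono) auto
  then have low: "1 / 4 * \<epsilon> * real m * min ?U ?V \<le> (\<Sum>i\<in>{..<m} - S. d i)"
    using \<epsilon> by (simp add: min_mult_distrib_left mult_ac)
  \<comment> \<open>The minimum is dominated by both combinations, so this applies to whichever of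
    \<open>u\<close> and \<open>v\<close> has the smaller norm.\<close>
  have up: "(\<Sum>i\<in>S. d i) \<le> 1 / 8 * \<epsilon> * real m * L2_set w {..<n}"
    if "\<And>i. d i \<le> \<bar>\<Sum>j<n. a i j * w j\<bar>" for w
  proof -
    have "(\<Sum>i\<in>S. d i) \<le> (\<Sum>i\<in>S. \<bar>1\<bar> * \<bar>\<Sum>j<n. a i j * w j\<bar>)"
      using that by (intro sum_mono) simp
    also have "\<dots> \<le> L2_set (\<lambda>i. 1) S * L2_set (\<lambda>i. \<Sum>j<n. a i j * w j) S"
      by (rule L2_set_mult_ineq)
    also have "\<dots> \<le> (1 / 2 * sqrt (real m)) * (\<epsilon> / 4 * sqrt (real m) * L2_set w {..<n})"
    proof (intro mult_mono well_spread_L2_set_le[OF ws \<epsilon> S])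
      have "sqrt (real (card S)) \<le> sqrt (real m / 4)"
        using S4 by simp
      also have "\<dots> = 1 / 2 * sqrt (real m)"
        by (simp add: real_sqrt_divide)
      finally show "L2_set (\<lambda>i. 1) S \<le> 1 / 2 * sqrt (real m)"
        by (simp add: L2_set_constant)
    qed auto
    also have "\<dots> = 1 / 8 * \<epsilon> * (sqrt (real m) * sqrt (real m)) * L2_set w {..<n}"
      by simp
    finally show ?thesis
      by simp
  qed
  have "(\<Sum>i\<in>S. d i) \<le> 1 / 8 * \<epsilon> * real m * min ?U ?V"
    using up[of u] up[of v] by (cases "?U \<le> ?V") (auto simp: d_def min_def)
  with low show ?thesis
    by simp
qed

section \<open>From linear growth to sharpness\<close>

lemma norm2_vec_eq_L2_set: "z \<in> carrier_vec n \<Longrightarrow> norm2_vec z = L2_set (\<lambda>j. z $ j) {..<n}"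
  by (simp add: norm2_vec_def scalar_prod_def L2_set_def power2_eq_square atLeast0LessThan)

lemma norm2_vec_diff_eq_0_iff:
  assumes "x \<in> carrier_vec n" "y \<in> carrier_vec n"
  shows "norm2_vec (x - y) = 0 \<longleftrightarrow> x = y"
proof -
  have "norm2_vec (x - y) = L2_set (\<lambda>j. (x - y) $ j) {..<n}"
    using assms by (intro norm2_vec_eq_L2_set) auto
  then show ?thesis
    using assms by (auto simp: L2_set_eq_0_iff)
qed

lemma norm2_vec_nonneg: "0 \<le> norm2_vec z"
  by (simp add: norm2_vec_def scalar_prod_def sum_nonneg)

text \<open>Growth forces every minimiser to be at distance zero from \<open>xs\<close> or
  \<open>- xs\<close>, and symmetry makes both of them minimisers. The two points may
  coincide.\<close>

lemma sharp_if_linear_growth_from_pair: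
  assumes xs: "xs \<in> carrier_vec n" and sym: "f (- xs) = f xs" and c: "c > 0"
    and growth: "\<And>x. x \<in> carrier_vec n \<Longrightarrow>
      f xs + c * min (norm2_vec (x - xs)) (norm2_vec (x + xs)) \<le> f x"
  shows "sharp n f"
proof -
  have nx: "- xs \<in> carrier_vec n"
    using xs by simp
  have plus: "x + xs = x - (- xs)" if "x \<in> carrier_vec n" for x
    using that xs by (intro eq_vecI) auto
  have ge: "f xs \<le> f x" if "x \<in> carrier_vec n" for x
  proof -
    have "0 \<le> c * min (norm2_vec (x - xs)) (norm2_vec (x + xs))"
      using c by (simp add: norm2_vec_nonneg)
    with growth[OF that] show ?thesis
      by linarith
  qed
  have argmin: "argmin_vec n f = {xs, - xs}"
  proof (intro equalityI subsetI)
    fix x assume x: "x \<in> argmin_vec n f"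
    then have xc: "x \<in> carrier_vec n" and "\<not> f xs < f x"
      using xs by (auto simp: argmin_vec_def is_arg_min_def)
    with growth[OF xc] have "c * min (norm2_vec (x - xs)) (norm2_vec (x + xs)) \<le> 0"
      by linarith
    then have "norm2_vec (x - xs) = 0 \<or> norm2_vec (x + xs) = 0"
      using c norm2_vec_nonneg[of "x - xs"] norm2_vec_nonneg[of "x + xs"]
      by (auto simp: mult_le_0_iff min_le_iff_disj)
    then show "x \<in> {xs, - xs}"
      using norm2_vec_diff_eq_0_iff[OF xc xs] norm2_vec_diff_eq_0_iff[OF xc nx] plus[OF xc] by auto
  next
    fix x assume "x \<in> {xs, - xs}"
    then have "x \<in> carrier_vec n" "f x = f xs"
      using xs nx sym by auto
    then show "x \<in> argmin_vec n f"
      using ge by (auto simp: argmin_vec_def is_arg_min_def not_less)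
  qed
  \<comment> \<open>Upper bounds on the infimum and on the distance suffice, since both stand on the
    smaller side of the sharpness inequality.\<close>
  have "(INF y\<in>carrier_vec n. f y) \<le> f xs"
    using ge xs by (intro cINF_lower bdd_belowI2[where m = "f xs"]) auto
  moreover have "c * dist_vec_set x {xs, - xs} \<le> c * min (norm2_vec (x - xs)) (norm2_vec (x + xs))"
    if x: "x \<in> carrier_vec n" for x
    unfolding dist_vec_set_def plus[OF x] using c
    by (intro mult_left_mono min.boundedI cINF_lower) auto
  ultimately have "\<forall>x\<in>carrier_vec n.
      f x \<ge> (INF y\<in>carrier_vec n. f y) + c * dist_vec_set x {xs, - xs}"
    using growth by (meson add_mono order_trans)
  then show ?thesis
    unfolding sharp_def argmin using c by blast
qed

section \<open>Growth of the phase retrieval loss\<close>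

lemma phase_loss_eq:
  assumes "A \<in> carrier_mat m n" "x \<in> carrier_vec n" "b \<in> carrier_vec m"
  shows "phase_loss p A b x = (\<Sum>i<m. \<bar>\<bar>\<Sum>j<n. A $$ (i, j) * x $ j\<bar> ^ p - b $ i\<bar>) / real m"
  using assms by (simp add: phase_loss_def norm1_vec_def abs_pow_vec_def scalar_prod_def atLeast0LessThan)

lemma abs_abs_diff_eq_min: "\<bar>\<bar>x\<bar> - \<bar>y\<bar>\<bar> = min \<bar>x - y\<bar> \<bar>x + y\<bar>" for x y :: real
  by (cases "0 \<le> x"; cases "0 \<le> y"; simp add: min_def; linarith)

text \<open>Outside \<open>S\<close> the residual of \<open>z\<close> vanishes, so that of
  \<open>y\<close> is the whole increment; on \<open>S\<close> the triangle inequality loses at most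
  one increment.\<close>

lemma sum_abs_diff_outliers:
  fixes y z b :: "nat \<Rightarrow> real" and m :: nat
  defines "S \<equiv> {i. i < m \<and> z i \<noteq> b i}"
  shows "(\<Sum>i<m. \<bar>z i - b i\<bar>) + ((\<Sum>i\<in>{..<m} - S. \<bar>y i - z i\<bar>) - (\<Sum>i\<in>S. \<bar>y i - z i\<bar>))
    \<le> (\<Sum>i<m. \<bar>y i - b i\<bar>)"
proof -
  have S: "S \<subseteq> {..<m}"
    by (auto simp: S_def)
  have split: "(\<Sum>i<m. g i) = (\<Sum>i\<in>{..<m} - S. g i) + (\<Sum>i\<in>S. g i)" for g :: "nat \<Rightarrow> real"
    using S by (intro sum.subset_diff) auto
  have "(\<Sum>i\<in>{..<m} - S. \<bar>z i - b i\<bar> + \<bar>y i - z i\<bar>) \<le> (\<Sum>i\<in>{..<m} - S. \<bar>y i - b i\<bar>)"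
    by (intro sum_mono) (auto simp: S_def)
  moreover have "(\<Sum>i\<in>S. \<bar>z i - b i\<bar> - \<bar>y i - z i\<bar>) \<le> (\<Sum>i\<in>S. \<bar>y i - b i\<bar>)"
    by (intro sum_mono) auto
  ultimately show ?thesis
    unfolding split sum.distrib sum_subtractf by linarith
qed

text \<open>For \<open>p = 2\<close> the growth constant is proportional to the norm of
  \<open>xs\<close>, hence the condition \<open>nz\<close>: with \<open>xs\<close> and
  \<open>b\<close> zero the loss is a quadratic form, which does not grow linearly from
  zero.\<close>

lemma sharp_phase_loss:
  assumes ws: "well_spread \<epsilon> (\<epsilon>\<^sup>2 / 16) s m n (\<lambda>i j. A $$ (i, j))"
    and \<epsilon>: "0 < \<epsilon>" and s: "s \<le> 1 / 4" and m: "0 < m" and p: "p \<in> {1, 2}"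
    and A: "A \<in> carrier_mat m n" and xs: "xs \<in> carrier_vec n" and b: "b \<in> carrier_vec m"
    and nz: "p = 2 \<Longrightarrow> xs \<noteq> 0\<^sub>v n"
    and outliers: "real (norm0_vec (abs_pow_vec p (A *\<^sub>v xs) - b)) \<le> s * real m"
  shows "sharp n (phase_loss p A b)"
proof -
  define L where "L x i = (\<Sum>j<n. A $$ (i, j) * x $ j)" for x i
  define S where "S = {i. i < m \<and> \<bar>L xs i\<bar> ^ p \<noteq> b $ i}"
  have S: "S \<subseteq> {..<m}" "real (card S) \<le> s * real m"
  proof -
    have "{i. i < dim_vec (abs_pow_vec p (A *\<^sub>v xs) - b) \<and> (abs_pow_vec p (A *\<^sub>v xs) - b) $ i \<noteq> 0} = S"
      using A xs b by (auto simp: S_def L_def abs_pow_vec_def scalar_prod_def atLeast0LessThan)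
    then show "S \<subseteq> {..<m}" "real (card S) \<le> s * real m"
      using outliers unfolding norm0_vec_def by (auto simp: S_def)
  qed
  have loss: "phase_loss p A b x = (\<Sum>i<m. \<bar>\<bar>L x i\<bar> ^ p - b $ i\<bar>) / real m"
    if "x \<in> carrier_vec n" for x
    unfolding L_def by (rule phase_loss_eq[OF A that b])
  have L_neg: "L (- xs) i = - L xs i" for i
    using xs by (simp add: L_def sum_negf)
  have sym: "phase_loss p A b (- xs) = phase_loss p A b xs"
    using xs by (simp add: loss L_neg)
  have L_comb: "(\<Sum>j<n. A $$ (i, j) * (x $ j - xs $ j)) = L x i - L xs i"
      "(\<Sum>j<n. A $$ (i, j) * (x $ j + xs $ j)) = L x i + L xs i" for x i
    by (simp_all add: L_def right_diff_distrib distrib_left sum_subtractf sum.distrib)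
  have norms: "norm2_vec (x - xs) = L2_set (\<lambda>j. x $ j - xs $ j) {..<n}"
      "norm2_vec (x + xs) = L2_set (\<lambda>j. x $ j + xs $ j) {..<n}" if "x \<in> carrier_vec n" for x
    using that xs by (auto simp: norm2_vec_eq_L2_set[of _ n] intro!: L2_set_cong)
  let ?d = "\<lambda>x i. \<bar>\<bar>L x i\<bar> ^ p - \<bar>L xs i\<bar> ^ p\<bar>"
  have loss_gap: "phase_loss p A b xs + k \<le> phase_loss p A b x"
    if "x \<in> carrier_vec n" "real m * k \<le> (\<Sum>i\<in>{..<m} - S. ?d x i) - (\<Sum>i\<in>S. ?d x i)" for x k
  proof -
    have "(\<Sum>i<m. \<bar>\<bar>L xs i\<bar> ^ p - b $ i\<bar>) + real m * k \<le> (\<Sum>i<m. \<bar>\<bar>L x i\<bar> ^ p - b $ i\<bar>)"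
      using sum_abs_diff_outliers[where m = m and y = "\<lambda>i. \<bar>L x i\<bar> ^ p"
          and z = "\<lambda>i. \<bar>L xs i\<bar> ^ p" and b = "\<lambda>i. b $ i"] that(2)
      unfolding S_def by linarith
    then have "((\<Sum>i<m. \<bar>\<bar>L xs i\<bar> ^ p - b $ i\<bar>) + real m * k) / real m
        \<le> (\<Sum>i<m. \<bar>\<bar>L x i\<bar> ^ p - b $ i\<bar>) / real m"
      by (intro divide_right_mono) auto
    then show ?thesis
      using m by (simp add: loss[OF that(1)] loss[OF xs] add_divide_distrib)
  qed
  show ?thesis
  proof (cases "p = 1")
    case True
    show ?thesis
    proof (rule sharp_if_linear_growth_from_pair[OF xs sym])
      show "0 < \<epsilon> / 8"
        using \<epsilon> by simp
      fix x :: "real vec" assume x: "x \<in> carrier_vec n"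
      let ?D = "min (norm2_vec (x - xs)) (norm2_vec (x + xs))"
      have d: "?d x i = min \<bar>L x i - L xs i\<bar> \<bar>L x i + L xs i\<bar>" for i
        unfolding True power_one_right by (rule abs_abs_diff_eq_min)
      have "real m * (\<epsilon> / 8 * ?D) = 1 / 8 * \<epsilon> * real m * ?D"
        by simp
      also have "\<dots> \<le> (\<Sum>i\<in>{..<m} - S. ?d x i) - (\<Sum>i\<in>S. ?d x i)"
        unfolding d norms[OF x]
        by (rule well_spread_min_gap[OF ws \<epsilon> s S, of "\<lambda>j. x $ j - xs $ j" "\<lambda>j. x $ j + xs $ j",
              unfolded L_comb])
      finally show "phase_loss p A b xs + \<epsilon> / 8 * ?D \<le> phase_loss p A b x"
        by (rule loss_gap[OF x])
    qed
  next
    case False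
    with p have p2: "p = 2"
      by simp
    let ?N = "L2_set (\<lambda>j. xs $ j) {..<n}"
    have "?N \<noteq> 0"
      using nz[OF p2] xs by (auto simp: L2_set_eq_0_iff)
    then have N: "0 < ?N"
      by (simp add: order_less_le)
    show ?thesis
    proof (rule sharp_if_linear_growth_from_pair[OF xs sym])
      show "0 < 3 / 16 * \<epsilon>\<^sup>2 * ?N"
        using \<epsilon> N by simp
      fix x :: "real vec" assume x: "x \<in> carrier_vec n"
      let ?u = "\<lambda>j. x $ j - xs $ j" and ?v = "\<lambda>j. x $ j + xs $ j"
      define U where "U = L2_set ?u {..<n}"
      define V where "V = L2_set ?v {..<n}"
      have UV: "0 \<le> U" "0 \<le> V"
        by (auto simp: U_def V_def)
      \<comment> \<open>As \<open>2 * xs\<close> is the difference of \<open>x + xs\<close> and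
        \<open>x - xs\<close>, the longer of these has norm at least \<open>?N\<close>; the product
        \<open>U * V\<close> then dominates \<open>?N\<close> times the shorter norm.\<close>
      have "2 * ?N = L2_set (\<lambda>j. ?v j + (- 1) * ?u j) {..<n}"
        by (simp add: L2_set_cmult[of 2, symmetric, simplified])
      also have "\<dots> \<le> V + U"
        using L2_set_triangle_ineq[of ?v "\<lambda>j. (- 1) * ?u j" "{..<n}"]
        unfolding L2_set_cmult U_def V_def by simp
      finally have "?N \<le> max U V"
        by linarith
      then have "?N * min U V \<le> max U V * min U V"
        using UV by (intro mult_right_mono) auto
      also have "\<dots> = U * V"
        by (auto simp: max_def min_def)
      finally have "3 / 16 * \<epsilon>\<^sup>2 * real m * (?N * min U V) \<le> 3 / 16 * \<epsilon>\<^sup>2 * real m * (U * V)"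
        by (intro mult_left_mono) auto
      also have "\<dots> \<le> (\<Sum>i\<in>{..<m} - S. ?d x i) - (\<Sum>i\<in>S. ?d x i)"
      proof -
        have d: "?d x i = \<bar>L x i - L xs i\<bar> * \<bar>L x i + L xs i\<bar>" for i
          unfolding p2 power2_abs abs_mult[symmetric]
          by (simp add: power2_eq_square algebra_simps)
        show ?thesis
          unfolding d U_def V_def
          by (rule well_spread_product_gap[OF ws \<epsilon> s S, of ?u ?v, unfolded L_comb])
      qed
      finally have "real m * (3 / 16 * \<epsilon>\<^sup>2 * ?N * min U V)
          \<le> (\<Sum>i\<in>{..<m} - S. ?d x i) - (\<Sum>i\<in>S. ?d x i)"
        by (simp only: mult_ac)
      from loss_gap[OF x this] show "phase_loss p A b xs
          + 3 / 16 * \<epsilon>\<^sup>2 * ?N * min (norm2_vec (x - xs)) (norm2_vec (x + xs)) \<le> phase_loss p A b x"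
        unfolding norms[OF x] U_def V_def .
    qed
  qed
qed

theorem theorem5p2:
  fixes p :: nat
  assumes "p \<in> {1, 2}"
  shows "\<exists>C c0 c1 s :: real. C > 0 \<and> c0 > 0 \<and> c1 > 0 \<and> 0 < s \<and> s < 1 \<and>
    (\<forall>(m::nat) (n::nat) (M :: 'w measure) (A :: 'w \<Rightarrow> real mat)
       (xs :: 'w \<Rightarrow> real vec) (b :: 'w \<Rightarrow> real vec).
       iid_gaussian_matrix M m n A \<longrightarrow>
       (\<forall>\<omega>\<in>space M. xs \<omega> \<in> carrier_vec n \<and> b \<omega> \<in> carrier_vec m) \<longrightarrow>
       (AE \<omega> in M. p = 2 \<longrightarrow> xs \<omega> \<noteq> 0\<^sub>v n) \<longrightarrow>
       (AE \<omega> in M. real (norm0_vec (abs_pow_vec p (A \<omega> *\<^sub>v xs \<omega>) - b \<omega>)) \<le> s * real m) \<longrightarrow>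
       real m \<ge> c0 * real n \<longrightarrow>
       with_prob_at_least M (1 - C * exp (- c1 * real m))
         (\<lambda>\<omega>. sharp n (phase_loss p (A \<omega>) (b \<omega>))))"
proof -
  obtain \<epsilon> s c0 c1 :: real where \<epsilon>: "0 < \<epsilon>" and s: "0 < s" "s \<le> 1 / 4" and c: "0 < c0" "0 < c1"
    and spread: "\<And>m n (M :: 'w measure) A. iid_gaussian_matrix M m n A \<Longrightarrow> c0 * real n \<le> real m \<Longrightarrow>
       \<exists>E\<in>sets M. 1 - 2 * exp (- c1 * real m) \<le> measure M E \<and>
         (\<forall>\<omega>\<in>E. well_spread \<epsilon> (\<epsilon>\<^sup>2 / 16) s m n (\<lambda>i j. A \<omega> $$ (i, j)))"
    by (rule gaussian_well_spread) (rule that)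
  have "with_prob_at_least M (1 - 2 * exp (- c1 * real m)) (\<lambda>\<omega>. sharp n (phase_loss p (A \<omega>) (b \<omega>)))"
    if iid: "iid_gaussian_matrix M m n A"
      and dims: "\<forall>\<omega>\<in>space M. xs \<omega> \<in> carrier_vec n \<and> b \<omega> \<in> carrier_vec m"
      and nz: "AE \<omega> in M. p = 2 \<longrightarrow> xs \<omega> \<noteq> 0\<^sub>v n"
      and outliers: "AE \<omega> in M. real (norm0_vec (abs_pow_vec p (A \<omega> *\<^sub>v xs \<omega>) - b \<omega>)) \<le> s * real m"
      and mn: "c0 * real n \<le> real m"
    for m n and M :: "'w measure" and A xs b
  proof (cases "m = 0")
    case True
    \<comment> \<open>Without rows the probability bound is \<open>1 - 2\<close>, which is negative,
      so the empty event serves.\<close>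
    then show ?thesis
      by (auto simp: with_prob_at_least_def intro!: bexI[of _ "{}"])
  next
    case False
    interpret prob_space M
      using iid by (simp add: iid_gaussian_matrix_def)
    obtain E where E: "E \<in> sets M" "1 - 2 * exp (- c1 * real m) \<le> prob E"
      "\<And>\<omega>. \<omega> \<in> E \<Longrightarrow> well_spread \<epsilon> (\<epsilon>\<^sup>2 / 16) s m n (\<lambda>i j. A \<omega> $$ (i, j))"
      using spread[OF iid mn] by blast
    from nz outliers have "AE \<omega> in M. (p = 2 \<longrightarrow> xs \<omega> \<noteq> 0\<^sub>v n) \<and>
        real (norm0_vec (abs_pow_vec p (A \<omega> *\<^sub>v xs \<omega>) - b \<omega>)) \<le> s * real m"
      by eventually_elim simp
    \<comment> \<open>The exceptional set need not be measurable; a null set covering it can be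
      removed from \<open>E\<close> without loss of probability.\<close>
    then obtain Z where Z: "{\<omega> \<in> space M. \<not> ((p = 2 \<longrightarrow> xs \<omega> \<noteq> 0\<^sub>v n) \<and>
        real (norm0_vec (abs_pow_vec p (A \<omega> *\<^sub>v xs \<omega>) - b \<omega>)) \<le> s * real m)} \<subseteq> Z"
      "Z \<in> null_sets M"
      unfolding eventually_ae_filter by blast
    have "measure M (E - Z) = measure M E"
      using E(1) Z(2) by (rule measure_Diff_null_set)
    moreover have "sharp n (phase_loss p (A \<omega>) (b \<omega>))" if \<omega>: "\<omega> \<in> E - Z" for \<omega>
    proof -
      have "\<omega> \<in> space M"
        using \<omega> sets.sets_into_space[OF E(1)] by auto
      then show ?thesis
        using \<omega> Z(1) dims iid False
        by (intro sharp_phase_loss[OF E(3) \<epsilon> s(2) _ assms, where xs = "xs \<omega>"])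
          (auto simp: iid_gaussian_matrix_def)
    qed
    ultimately show ?thesis
      unfolding with_prob_at_least_def using E Z(2) by (intro bexI[of _ "E - Z"]) auto
  qed
  note main = this
  show ?thesis
  \<comment> \<open>The factor 2 counts the two ways in which a net point can fail.\<close>
  proof (rule exI[of _ 2], rule exI[of _ c0], rule exI[of _ c1], rule exI[of _ s],
      intro conjI allI impI)
    show "s < 1"
      using s by simp
  qed (fact c s zero_less_numeral | rule main; assumption)+
qed

end
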